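(* Let $k$ be a number field (in particular, $k=\mathbb{Q}$ is allowed) and let $k^{ab}$ be its maximal abelian extension. Then $k^{ab}$ and all finite extensions of $k^{ab}$ are rootless modtor. Moreover, these fields are all of good heredity.
   Context: Let $F$ be a field with algebraic closure $F^{alg}$. A polynomial $P \in F[x]$ is hereditarily irreducible over $F$ if for every integer $n\ge 1$ the polynomial $P(x^n)$ is irreducible over $F$. A polynomial $P\in F[x]$ has good heredity (over $F$) if for some integer $n \geq 1$ the polynomial $P(x^n)$ factors (up to a nonzero constant) as a product of polynomials in $F[x]$ that are hereditarily irreducible over $F$. The field $F$ has good heredity if every polynomial $P \in F[x]$, none of whose roots in $F^{alg}$ is zero or a root of unity, has good heredity over $F$. An element $a\in F$ that is not a root of unity is rootless modtor (in $F$) if for all but finitely many integers $n\ge 1$, for every root of unity $\zeta \in F$ the equation $x^n=\zeta a$ has no solution in $F$. The field $F$ is rootless modtor if every nonzero $f \in F$ that is not a root of unity is rootless modtor in $F$. *)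

theory Defs
  imports
    "HOL-Algebra.Algebra"
    "HOL-Algebra.Algebraic_Closure_Type"
    "HOL-Library.Infinite_Set"
begin

text \<open>
  All fields are subfields of an ambient algebraically closed field, the type \<open>'a\<close>, regarded
  through \<^const>\<open>ring_of_type_algebra\<close> as a structure in the sense of HOL-Algebra.  In particular
  the algebraic closure of a subfield \<open>F\<close> is the set of elements of \<open>'a\<close> algebraic over \<open>F\<close>.
\<close>

abbreviation ambient :: "'a :: field ring" where
  "ambient \<equiv> ring_of_type_algebra"

section \<open>Field extensions\<close>

definition finite_extension :: "'a :: field set \<Rightarrow> 'a set \<Rightarrow> bool" where
  "finite_extension K L \<longleftrightarrow>
     subfield K ambient \<and> subfield L ambient \<and> K \<subseteq> L \<and> ring.finite_dimension ambient K L"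

definition number_field :: "'a :: field_char_0 set \<Rightarrow> bool" where
  "number_field k \<longleftrightarrow> finite_extension \<rat> k"

definition polys_over :: "'a :: field set \<Rightarrow> 'a poly set" where
  "polys_over F = {p. \<forall>i. poly.coeff p i \<in> F}"

definition algebraic_over :: "'a :: field set \<Rightarrow> 'a \<Rightarrow> bool" where
  "algebraic_over F x \<longleftrightarrow> (\<exists>p\<in>polys_over F. p \<noteq> 0 \<and> poly p x = 0)"

text \<open>
  Automorphisms are unconstrained outside \<open>L\<close>, so they may only be compared on \<open>L\<close>.
\<close>

definition automorphisms_over :: "'a :: field set \<Rightarrow> 'a set \<Rightarrow> ('a \<Rightarrow> 'a) set" where
  "automorphisms_over k L =
     {\<sigma> \<in> ring_iso (ambient\<lparr>carrier := L\<rparr>) (ambient\<lparr>carrier := L\<rparr>). \<forall>x\<in>k. \<sigma> x = x}"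

definition galois_extension :: "'a :: field set \<Rightarrow> 'a set \<Rightarrow> bool" where
  "galois_extension k L \<longleftrightarrow>
     subfield k ambient \<and> subfield L ambient \<and> k \<subseteq> L \<and>
     (\<forall>x\<in>L. algebraic_over k x) \<and>
     {x \<in> L. \<forall>\<sigma>\<in>automorphisms_over k L. \<sigma> x = x} = k"

definition abelian_extension :: "'a :: field set \<Rightarrow> 'a set \<Rightarrow> bool" where
  "abelian_extension k L \<longleftrightarrow>
     galois_extension k L \<and>
     (\<forall>\<sigma>\<in>automorphisms_over k L. \<forall>\<tau>\<in>automorphisms_over k L. \<forall>x\<in>L. \<sigma> (\<tau> x) = \<tau> (\<sigma> x))"

text \<open>
  The compositum of all abelian extensions of \<open>k\<close> inside the (algebraically closed) ambient field.
\<close>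

definition maximal_abelian_extension :: "'a :: alg_closed_field set \<Rightarrow> 'a set" where
  "maximal_abelian_extension k = generate_field ambient (\<Union>{L. abelian_extension k L})"

section \<open>Heredity\<close>

text \<open>
  The ring $F[x]$ is the subring of \<open>'a poly\<close> with carrier \<^term>\<open>polys_over F\<close>; factors and units
  in the following definition are taken in that ring.
\<close>

definition irreducible_over :: "'a :: field set \<Rightarrow> 'a poly \<Rightarrow> bool" where
  "irreducible_over F P \<longleftrightarrow>
     P \<in> polys_over F \<and> ring_irreducible\<^bsub>ring_of_type_algebra\<lparr>carrier := polys_over F\<rparr>\<^esub> P"

definition subst_power :: "nat \<Rightarrow> 'a :: field poly \<Rightarrow> 'a poly" where
  "subst_power n P = pcompose P (Polynomial.monom 1 n)"

definition hereditarily_irreducible :: "'a :: field set \<Rightarrow> 'a poly \<Rightarrow> bool" where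
  "hereditarily_irreducible F P \<longleftrightarrow>
     P \<in> polys_over F \<and> (\<forall>n\<ge>1. irreducible_over F (subst_power n P))"

definition poly_has_good_heredity :: "'a :: field set \<Rightarrow> 'a poly \<Rightarrow> bool" where
  "poly_has_good_heredity F P \<longleftrightarrow>
     P \<in> polys_over F \<and>
     (\<exists>n\<ge>1. \<exists>c\<in>F - {0}. \<exists>Qs. (\<forall>Q\<in>set Qs. hereditarily_irreducible F Q) \<and>
        subst_power n P = Polynomial.smult c (prod_list Qs))"

definition root_of_unity :: "'a :: field \<Rightarrow> bool" where
  "root_of_unity x \<longleftrightarrow> (\<exists>n::nat. n \<ge> 1 \<and> x ^ n = 1)"

text \<open>
  The polynomial $P = 0$ is excluded by the condition on the roots, since it has the root $0$.
\<close>

definition field_has_good_heredity :: "'a :: alg_closed_field set \<Rightarrow> bool" where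
  "field_has_good_heredity F \<longleftrightarrow>
     (\<forall>P\<in>polys_over F.
        (\<forall>\<alpha>. algebraic_over F \<alpha> \<and> poly P \<alpha> = 0 \<longrightarrow> \<alpha> \<noteq> 0 \<and> \<not> root_of_unity \<alpha>) \<longrightarrow>
        poly_has_good_heredity F P)"

section \<open>Rootlessness modulo torsion\<close>

definition rootless_modtor_element :: "'a :: field set \<Rightarrow> 'a \<Rightarrow> bool" where
  "rootless_modtor_element F a \<longleftrightarrow>
     (\<forall>\<^sub>\<infinity>n. n \<ge> 1 \<longrightarrow> (\<forall>\<zeta>\<in>F. root_of_unity \<zeta> \<longrightarrow> \<not> (\<exists>x\<in>F. x ^ n = \<zeta> * a)))"

definition rootless_modtor :: "'a :: field set \<Rightarrow> bool" where
  "rootless_modtor F \<longleftrightarrow>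
     (\<forall>f\<in>F. f \<noteq> 0 \<and> \<not> root_of_unity f \<longrightarrow> rootless_modtor_element F f)"

end

theory Submission
  imports Defs
begin

text \<open>
  Let \<open>K\<close> be the maximal abelian extension of the number field \<open>k\<close> and let \<open>F\<close> be a finite
  extension of \<open>K\<close>. Cyclotomic extensions are abelian, so \<open>F\<close> contains all roots of unity. Both
  halves of the theorem rest on one finiteness statement
  (\<open>finite_radical_exponents_over_maximal_abelian_extension\<close>): if \<open>a \<in> F\<close> is neither zero nor a
  root of unity, then \<open>y ^ n = a\<close> is solvable in \<open>F\<close> for only finitely many \<open>n\<close>. Since every root
  of unity in \<open>F\<close> is an \<open>n\<close>-th power in \<open>F\<close>, this is the same as \<open>a\<close> being rootless modulo torsion.

  For the finiteness, adjoin to \<open>k\<close> the element \<open>a\<close> and finitely many generators of \<open>F\<close> over \<open>K\<close>;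
  this gives a number field \<open>k'\<close>. Conjugations of the algebraic closure over \<open>k'\<close> commute with each
  other on \<open>K\<close> and fix the generators, so they commute on \<open>F\<close>, even if \<open>F\<close> is not normal over \<open>k'\<close>.
  Let \<open>y \<in> F\<close> with \<open>y ^ n = a\<close>. If \<open>\<sigma>\<close> raises the \<open>n\<close>-th roots of unity to the power \<open>t\<close>,
  then commutativity makes \<open>\<sigma> y / y ^ t\<close> invariant under all conjugations, hence an element of \<open>k'\<close>,
  and so \<open>a ^ (t - 1)\<close> is an \<open>n\<close>-th power in \<open>k'\<close>. It follows (\<open>abelian_radical\<close>) that \<open>a ^ g\<close> is an
  \<open>n\<close>-th power in \<open>k'\<close> for some \<open>g\<close> such that \<open>k'\<close> contains a primitive \<open>g\<close>-th root of unity. A number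
  field contains only finitely many radicals of a given element, of whatever exponent
  (\<open>finite_radicals_in_number_field\<close>, an instance of Northcott's finiteness argument). This bounds
  \<open>g\<close>, as the roots of unity are the radicals of \<open>1\<close>, and then bounds \<open>n\<close>, as a fixed \<open>z\<close> satisfies
  \<open>z ^ n = a ^ g\<close> for at most one \<open>n\<close> when \<open>a\<close> is not a root of unity.

  For good heredity, let \<open>\<gamma> \<noteq> 0\<close> be a root of an irreducible polynomial \<open>Q\<close> over \<open>F\<close>. As \<open>F\<close> contains
  the roots of unity, Kummer theory says that \<open>Q(x^m)\<close> is irreducible for every \<open>m\<close> as soon as \<open>\<gamma>\<close> is
  not a \<open>p\<close>-th power in \<open>F(\<gamma>)\<close> for any prime \<open>p\<close> (\<open>irreducible_subst_power\<close>). Given \<open>P\<close>, extract from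
  each root \<open>\<alpha>\<close> of \<open>P\<close> a root of the largest exponent \<open>n(\<alpha>)\<close> that exists in \<open>F(\<alpha>)\<close>; the finiteness
  statement, applied to the finite extension \<open>F(\<alpha>)\<close> of \<open>K\<close>, says that there is a largest one. For \<open>N\<close>
  the product of the \<open>n(\<alpha>)\<close>, all irreducible factors of \<open>P(x^N)\<close> are hereditarily irreducible
  (\<open>good_heredity_if_roots_bounded\<close>).

  The conjugations used above are homomorphisms of the algebraic closure of \<open>k'\<close> into itself. They are
  obtained from Zorn's lemma, by extending graphs of isomorphisms between subfields.
\<close>

section \<open>The ambient field\<close>

lemma carrier_ambient [simp]: "carrier ambient = UNIV"
  and zero_ambient [simp]: "\<zero>\<^bsub>ambient\<^esub> = 0"
  and one_ambient [simp]: "\<one>\<^bsub>ambient\<^esub> = 1"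
  and add_ambient [simp]: "x \<oplus>\<^bsub>ambient\<^esub> y = x + y"
  and mult_ambient [simp]: "x \<otimes>\<^bsub>ambient\<^esub> y = x * y"
  by (simp_all add: ring_of_type_algebra_def)

lemma minus_ambient [simp]: "\<ominus>\<^bsub>ambient\<^esub> x = - x"
proof -
  interpret field "ambient :: 'a ring" by (rule field_from_type_algebra)
  show ?thesis by (rule minus_equality) simp_all
qed

lemma inv_ambient [simp]:
  assumes "x \<noteq> 0"
  shows "inv\<^bsub>ambient\<^esub> x = inverse x"
proof -
  interpret field "ambient :: 'a ring" by (rule field_from_type_algebra)
  show ?thesis by (rule comm_inv_char) (use assms in simp_all)
qed

lemma subfield_ambientI:
  fixes F :: "'a :: field set"
  assumes "1 \<in> F" "\<And>x y. x \<in> F \<Longrightarrow> y \<in> F \<Longrightarrow> x + y \<in> F" "\<And>x y. x \<in> F \<Longrightarrow> y \<in> F \<Longrightarrow> x * y \<in> F"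
    "\<And>x. x \<in> F \<Longrightarrow> - x \<in> F" "\<And>x. x \<in> F \<Longrightarrow> inverse x \<in> F"
  shows "subfield F ambient"
proof -
  interpret field "ambient :: 'a ring" by (rule field_from_type_algebra)
  show ?thesis
  proof (rule subfieldI')
    show "subring F ambient" by (rule subringI) (auto simp: assms)
  qed (use assms in auto)
qed

lemma subfield_ambientD:
  fixes F :: "'a :: field set"
  assumes F: "subfield F ambient"
  shows "0 \<in> F" "1 \<in> F" "x \<in> F \<Longrightarrow> y \<in> F \<Longrightarrow> x + y \<in> F" "x \<in> F \<Longrightarrow> y \<in> F \<Longrightarrow> x * y \<in> F"
    "x \<in> F \<Longrightarrow> - x \<in> F" "x \<in> F \<Longrightarrow> y \<in> F \<Longrightarrow> x - y \<in> F" "x \<in> F \<Longrightarrow> inverse x \<in> F"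
    "x \<in> F \<Longrightarrow> y \<in> F \<Longrightarrow> x / y \<in> F" "x \<in> F \<Longrightarrow> x ^ n \<in> F" "of_nat n \<in> F"
proof -
  interpret field "ambient :: 'a ring" by (rule field_from_type_algebra)
  note S = subringE[OF subfieldE(1)[OF F], simplified]
  show zero: "0 \<in> F" and one: "1 \<in> F" and add: "\<And>x y. x \<in> F \<Longrightarrow> y \<in> F \<Longrightarrow> x + y \<in> F"
    and mult: "\<And>x y. x \<in> F \<Longrightarrow> y \<in> F \<Longrightarrow> x * y \<in> F" and minus: "\<And>x. x \<in> F \<Longrightarrow> - x \<in> F"
    using S by auto
  show inv: "inverse x \<in> F" if "x \<in> F" for x
    using subfield_m_inv(1)[OF F, of x] that zero by (cases "x = 0") auto
  show "x \<in> F \<Longrightarrow> y \<in> F \<Longrightarrow> x - y \<in> F" using add[of x "-y"] minus[of y] by auto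
  show "x \<in> F \<Longrightarrow> y \<in> F \<Longrightarrow> x / y \<in> F" using mult[OF _ inv] by (auto simp: divide_inverse)
  show "x \<in> F \<Longrightarrow> x ^ n \<in> F" using mult one by (induction n) auto
  show "of_nat n \<in> F" using zero one add by (induction n) auto
qed

section \<open>Field isomorphisms as graphs\<close>

text \<open>
  Isomorphisms between subfields are represented by their graphs, so that restricting, extending and
  taking unions of chains are operations on sets. A subfield \<open>F\<close> appears as its diagonal \<open>Id_on F\<close>;
  facts about pairs of corresponding polynomials then specialise to facts about polynomials over \<open>F\<close>.
\<close>

definition field_corr :: "('a :: field \<times> 'a) set \<Rightarrow> bool" where
  "field_corr G \<longleftrightarrow> (1, 1) \<in> G \<and>
     (\<forall>(x, x')\<in>G. \<forall>(y, y')\<in>G. (x + y, x' + y') \<in> G \<and> (x * y, x' * y') \<in> G) \<and>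
     (\<forall>(x, x')\<in>G. (- x, - x') \<in> G \<and> (inverse x, inverse x') \<in> G \<and> (x = 0 \<longleftrightarrow> x' = 0))"

definition poly_corr :: "('a :: field \<times> 'a) set \<Rightarrow> 'a poly \<Rightarrow> 'a poly \<Rightarrow> bool" where
  "poly_corr G p q \<longleftrightarrow> (\<forall>i. (poly.coeff p i, poly.coeff q i) \<in> G)"

lemma field_corrD:
  assumes "field_corr G"
  shows "(1, 1) \<in> G" "(0, 0) \<in> G" "(x, x') \<in> G \<Longrightarrow> (y, y') \<in> G \<Longrightarrow> (x + y, x' + y') \<in> G"
    "(x, x') \<in> G \<Longrightarrow> (y, y') \<in> G \<Longrightarrow> (x * y, x' * y') \<in> G"
    "(x, x') \<in> G \<Longrightarrow> (- x, - x') \<in> G"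
    "(x, x') \<in> G \<Longrightarrow> (y, y') \<in> G \<Longrightarrow> (x - y, x' - y') \<in> G"
    "(x, x') \<in> G \<Longrightarrow> (y, y') \<in> G \<Longrightarrow> (x / y, x' / y') \<in> G"
    "(x, x') \<in> G \<Longrightarrow> x = 0 \<longleftrightarrow> x' = 0"
    "(x, x') \<in> G \<Longrightarrow> (y, y') \<in> G \<Longrightarrow> x = y \<longleftrightarrow> x' = y'"
proof -
  show one: "(1, 1) \<in> G" and add: "\<And>x x' y y'. (x, x') \<in> G \<Longrightarrow> (y, y') \<in> G \<Longrightarrow> (x + y, x' + y') \<in> G"
    and mult: "\<And>x x' y y'. (x, x') \<in> G \<Longrightarrow> (y, y') \<in> G \<Longrightarrow> (x * y, x' * y') \<in> G"
    and minus: "\<And>x x'. (x, x') \<in> G \<Longrightarrow> (- x, - x') \<in> G"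
    and zero_iff: "\<And>x x'. (x, x') \<in> G \<Longrightarrow> x = 0 \<longleftrightarrow> x' = 0"
    using assms by (auto simp: field_corr_def)
  have inv: "\<And>x x'. (x, x') \<in> G \<Longrightarrow> (inverse x, inverse x') \<in> G"
    using assms by (auto simp: field_corr_def)
  show "(0, 0) \<in> G" using add[OF one minus[OF one]] by simp
  show diff: "\<And>x x' y y'. (x, x') \<in> G \<Longrightarrow> (y, y') \<in> G \<Longrightarrow> (x - y, x' - y') \<in> G"
    using add[OF _ minus] by fastforce
  show "(x, x') \<in> G \<Longrightarrow> (y, y') \<in> G \<Longrightarrow> (x / y, x' / y') \<in> G"
    using mult[OF _ inv] by (auto simp: divide_inverse)
  show "(x, x') \<in> G \<Longrightarrow> (y, y') \<in> G \<Longrightarrow> x = y \<longleftrightarrow> x' = y'"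
    using zero_iff[OF diff] by fastforce
qed

lemma field_corr_sum:
  assumes "field_corr G" "\<And>i. i \<in> I \<Longrightarrow> (f i, g i) \<in> G"
  shows "(sum f I, sum g I) \<in> G"
  using assms(2) field_corrD(2,3)[OF assms(1)] by (induction I rule: infinite_finite_induct) auto

lemma field_corr_Id_on: "subfield F ambient \<Longrightarrow> field_corr (Id_on F)"
  by (auto simp: field_corr_def Id_on_iff subfield_ambientD)

lemma poly_corr_Id_on: "poly_corr (Id_on F) p q \<longleftrightarrow> p = q \<and> p \<in> polys_over F"
  by (auto simp: poly_corr_def Id_on_iff polys_over_def poly_eq_iff)

lemma poly_corr_closed:
  assumes G: "field_corr G"
  shows "poly_corr G 0 0" "poly_corr G 1 1"
    "poly_corr G p p' \<Longrightarrow> poly_corr G q q' \<Longrightarrow> poly_corr G (p + q) (p' + q')"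
    "poly_corr G p p' \<Longrightarrow> poly_corr G q q' \<Longrightarrow> poly_corr G (p - q) (p' - q')"
    "poly_corr G p p' \<Longrightarrow> poly_corr G (- p) (- p')"
    "poly_corr G p p' \<Longrightarrow> poly_corr G q q' \<Longrightarrow> poly_corr G (p * q) (p' * q')"
    "(c, c') \<in> G \<Longrightarrow> poly_corr G (Polynomial.monom c n) (Polynomial.monom c' n)"
    "(c, c') \<in> G \<Longrightarrow> poly_corr G p p' \<Longrightarrow> poly_corr G (pCons c p) (pCons c' p')"
    "(c, c') \<in> G \<Longrightarrow> poly_corr G p p' \<Longrightarrow> poly_corr G (Polynomial.smult c p) (Polynomial.smult c' p')"
  using field_corrD[OF G]
  by (auto simp: poly_corr_def coeff_mult coeff_pCons split: nat.splits intro!: field_corr_sum[OF G])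

lemma poly_corr_eq_0_iff:
  assumes "field_corr G" "poly_corr G p q"
  shows "p = 0 \<longleftrightarrow> q = 0"
proof -
  have "poly.coeff p i = 0 \<longleftrightarrow> poly.coeff q i = 0" for i
    using assms field_corrD(8)[OF assms(1), of "poly.coeff p i" "poly.coeff q i"]
    by (simp add: poly_corr_def)
  then show ?thesis by (simp add: poly_eq_iff)
qed

lemma poly_corr_degree:
  assumes "field_corr G" "poly_corr G p q"
  shows "degree p = degree q"
proof -
  have "poly.coeff p i = 0 \<longleftrightarrow> poly.coeff q i = 0" for i
    using assms field_corrD(8)[OF assms(1), of "poly.coeff p i" "poly.coeff q i"]
    by (simp add: poly_corr_def)
  then show ?thesis by (simp add: degree_def)
qed

lemma poly_corr_poly:
  assumes G: "field_corr G" and "poly_corr G p q" "(x, y) \<in> G"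
  shows "(poly p x, poly q y) \<in> G"
proof -
  have pow: "(x ^ i, y ^ i) \<in> G" for i
    using assms(3) by (induction i) (auto intro: field_corrD[OF G])
  show ?thesis
    using assms poly_corr_degree[OF G assms(2)] pow unfolding poly_altdef
    by (auto intro!: field_corr_sum field_corrD[OF G] simp: poly_corr_def)
qed

text \<open>
  Long division only performs field operations on coefficients, and these respect the correspondence.
\<close>

lemma poly_corr_divmod:
  assumes G: "field_corr G" and "poly_corr G p p'" and f: "poly_corr G f f'" "f \<noteq> 0"
  shows "poly_corr G (p div f) (p' div f') \<and> poly_corr G (p mod f) (p' mod f')"
  using assms(2)
proof (induction "length (coeffs p)" arbitrary: p p' rule: less_induct)
  case less
  have f': "f' \<noteq> 0" "degree f' = degree f"
    using poly_corr_eq_0_iff[OF G f(1)] poly_corr_degree[OF G f(1)] f(2) by auto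
  have p': "degree p' = degree p" "p' = 0 \<longleftrightarrow> p = 0"
    using poly_corr_eq_0_iff[OF G less.prems] poly_corr_degree[OF G less.prems] by auto
  show ?case
  proof (cases "p = 0 \<or> degree p < degree f")
    case True
    then show ?thesis using f' p' less.prems
      by (auto simp: div_poly_less mod_poly_less poly_corr_closed(1)[OF G])
  next
    case False
    \<comment> \<open>one step of long division, performed simultaneously on both sides\<close>
    define m where "m = Polynomial.monom (lead_coeff p / lead_coeff f) (degree p - degree f)"
    define m' where "m' = Polynomial.monom (lead_coeff p' / lead_coeff f') (degree p - degree f)"
    have m: "poly_corr G m m'"
      unfolding m_def m'_def
      by (rule poly_corr_closed[OF G], rule field_corrD[OF G])
        (use less.prems f(1) p' f' in \<open>auto simp: poly_corr_def\<close>)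
    define q where "q = p - m * f"
    define q' where "q' = p' - m' * f'"
    have q: "poly_corr G q q'"
      unfolding q_def q'_def by (intro poly_corr_closed[OF G] less.prems m f)
    have dm: "degree (m * f) = degree p" and cm: "poly.coeff (m * f) (degree p) = lead_coeff p"
    proof -
      have m0: "m \<noteq> 0" using False f(2) by (auto simp: m_def)
      have "degree m = degree p - degree f" using m0 by (auto simp: m_def degree_monom_eq)
      then show d: "degree (m * f) = degree p" using m0 f(2) False by (simp add: degree_mult_eq)
      have "poly.coeff (m * f) (degree (m * f)) = lead_coeff p"
        unfolding lead_coeff_mult using f(2) m0 by (auto simp: m_def degree_monom_eq)
      then show "poly.coeff (m * f) (degree p) = lead_coeff p" using d by simp
    qed
    have "q = 0 \<or> degree q < degree p"
    proof (rule eq_zero_or_degree_less)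
      show "degree q \<le> degree p" unfolding q_def using dm by (intro degree_diff_le) auto
      show "poly.coeff q (degree p) = 0" by (simp add: q_def cm)
    qed
    then have "length (coeffs q) < length (coeffs p)"
      using False by (cases "q = 0") (auto simp: length_coeffs_degree)
    from less.hyps[OF this q]
    have *: "poly_corr G (q div f) (q' div f')" "poly_corr G (q mod f) (q' mod f')" by auto
    have pe: "p = q + m * f" "p' = q' + m' * f'" by (simp_all add: q_def q'_def)
    show ?thesis
      unfolding pe using f(2) f'(1) * m
      by (auto intro!: poly_corr_closed[OF G])
  qed
qed

section \<open>Polynomials over a subfield\<close>

lemma polys_over_iff_poly_corr: "p \<in> polys_over F \<longleftrightarrow> poly_corr (Id_on F) p p"
  by (simp add: poly_corr_Id_on)

lemma polys_over_closed:
  assumes F: "subfield F ambient"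
  shows "0 \<in> polys_over F" "1 \<in> polys_over F"
    "p \<in> polys_over F \<Longrightarrow> q \<in> polys_over F \<Longrightarrow> p + q \<in> polys_over F"
    "p \<in> polys_over F \<Longrightarrow> q \<in> polys_over F \<Longrightarrow> p - q \<in> polys_over F"
    "p \<in> polys_over F \<Longrightarrow> - p \<in> polys_over F"
    "p \<in> polys_over F \<Longrightarrow> q \<in> polys_over F \<Longrightarrow> p * q \<in> polys_over F"
    "c \<in> F \<Longrightarrow> Polynomial.monom c n \<in> polys_over F"
    "c \<in> F \<Longrightarrow> p \<in> polys_over F \<Longrightarrow> pCons c p \<in> polys_over F"
    "c \<in> F \<Longrightarrow> p \<in> polys_over F \<Longrightarrow> Polynomial.smult c p \<in> polys_over F"
  using poly_corr_closed[OF field_corr_Id_on[OF F]]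
  by (simp_all add: polys_over_iff_poly_corr Id_on_iff)

lemma polys_over_divmod:
  assumes F: "subfield F ambient" and "p \<in> polys_over F" "f \<in> polys_over F" "f \<noteq> 0"
  shows "p div f \<in> polys_over F" "p mod f \<in> polys_over F"
  using poly_corr_divmod[OF field_corr_Id_on[OF F], of p p f f] assms
  by (simp_all add: polys_over_iff_poly_corr)

lemma coeff_polys_over: "p \<in> polys_over F \<Longrightarrow> poly.coeff p i \<in> F"
  by (simp add: polys_over_def)

lemma polys_over_mono: "F \<subseteq> E \<Longrightarrow> polys_over F \<subseteq> polys_over E"
  by (auto simp: polys_over_def)

lemma poly_in_subfield:
  assumes "subfield F ambient" "p \<in> polys_over F" "x \<in> F"
  shows "poly p x \<in> F"
  using poly_corr_poly[OF field_corr_Id_on[OF assms(1)], of p p x x] assms(2,3)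
  by (simp add: polys_over_iff_poly_corr Id_on_iff)

text \<open>
  A polynomial over \<open>F\<close> of least degree among those vanishing at \<open>x\<close> divides all the others, because the
  remainder is again over \<open>F\<close> and vanishes at \<open>x\<close>.
\<close>

lemma minimal_polynomial:
  assumes F: "subfield F ambient" and "algebraic_over F x"
  obtains f where "f \<in> polys_over F" "f \<noteq> 0" "poly f x = 0" "degree f > 0"
    "\<And>g. g \<in> polys_over F \<Longrightarrow> poly g x = 0 \<Longrightarrow> f dvd g"
proof -
  define P where "P f \<longleftrightarrow> f \<in> polys_over F \<and> f \<noteq> 0 \<and> poly f x = 0" for f
  have "\<exists>f. P f" using assms(2) by (auto simp: algebraic_over_def P_def)
  from exists_least_iff[THEN iffD1, of "\<lambda>n. \<exists>f. P f \<and> degree f = n"] this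
  obtain f where f: "P f" and min: "\<And>g. P g \<Longrightarrow> degree f \<le> degree g"
    by (metis not_less)
  have "f dvd g" if g: "g \<in> polys_over F" "poly g x = 0" for g
  proof (rule ccontr)
    assume "\<not> f dvd g"
    then have nz: "g mod f \<noteq> 0" by (auto simp: dvd_eq_mod_eq_0)
    have "poly (g mod f) x = poly (g - g div f * f) x" by (simp add: minus_div_mult_eq_mod)
    also have "\<dots> = 0" using f g by (auto simp: P_def)
    finally have "P (g mod f)" using nz polys_over_divmod[OF F g(1)] f by (auto simp: P_def)
    from min[OF this] show False
      using degree_mod_less'[of f g] f nz by (auto simp: P_def)
  qed
  moreover have "degree f > 0"
  proof (rule ccontr)
    assume "\<not> degree f > 0"
    then obtain c where "f = [:c:]" by (auto elim: degree_eq_zeroE)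
    then show False using f by (auto simp: P_def)
  qed
  ultimately show ?thesis using that f by (auto simp: P_def)
qed

text \<open>
  Units of the ring of polynomials over \<open>F\<close> are the nonzero constants, so ring-theoretic
  irreducibility can be expressed by degrees.
\<close>

lemma irreducible_over_iff:
  fixes F :: "'a :: field set"
  assumes F: "subfield F ambient"
  shows "irreducible_over F P \<longleftrightarrow> P \<in> polys_over F \<and> degree P > 0 \<and>
    (\<forall>A\<in>polys_over F. \<forall>B\<in>polys_over F. P = A * B \<longrightarrow> degree A = 0 \<or> degree B = 0)"
    (is "_ \<longleftrightarrow> ?R")
proof -
  define R where "R = (ring_of_type_algebra\<lparr>carrier := polys_over F\<rparr> :: 'a poly ring)"
  have R: "carrier R = polys_over F" "\<zero>\<^bsub>R\<^esub> = 0" "\<one>\<^bsub>R\<^esub> = 1" "\<And>x y. x \<otimes>\<^bsub>R\<^esub> y = x * y"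
    by (auto simp: R_def ring_of_type_algebra_def)
  have const: "A \<in> polys_over F \<and> A \<noteq> 0 \<and> degree A = 0 \<longleftrightarrow> A \<in> Units R" for A
  proof
    assume A: "A \<in> polys_over F \<and> A \<noteq> 0 \<and> degree A = 0"
    then obtain c where c: "A = [:c:]" "c \<noteq> 0" by (metis degree_eq_zeroE pCons_0_0)
    then have "c \<in> F" using A coeff_polys_over[of A F 0] by simp
    then have "[:inverse c:] \<in> polys_over F"
      by (intro polys_over_closed[OF F] subfield_ambientD[OF F])
    then show "A \<in> Units R" using A c
      by (auto simp: Units_def R intro!: bexI[of _ "[:inverse c:]"] simp: one_pCons)
  next
    assume "A \<in> Units R"
    then obtain B where B: "A \<in> polys_over F" "A * B = 1" by (auto simp: Units_def R)
    then have "degree A = 0"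
      by (metis degree_1 degree_mult_eq add_is_0 mult_eq_0_iff zero_neq_one)
    then show "A \<in> polys_over F \<and> A \<noteq> 0 \<and> degree A = 0" using B by auto
  qed
  have "ring_irreducible\<^bsub>R\<^esub> P \<longleftrightarrow> degree P > 0 \<and>
    (\<forall>A\<in>polys_over F. \<forall>B\<in>polys_over F. P = A * B \<longrightarrow> degree A = 0 \<or> degree B = 0)"
    if P: "P \<in> polys_over F"
  proof
    assume irr: "ring_irreducible\<^bsub>R\<^esub> P"
    then have P0: "P \<noteq> 0" and nu: "P \<notin> Units R"
      and pf: "\<And>b. b \<in> polys_over F \<Longrightarrow> properfactor R b P \<Longrightarrow> b \<in> Units R"
      by (auto simp: ring_irreducible_def Divisibility.irreducible_def R)
    have "degree P > 0" using nu P P0 const[of P] by auto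
    moreover have "degree A = 0 \<or> degree B = 0"
      if A: "A \<in> polys_over F" and B: "B \<in> polys_over F" and eq: "P = A * B" for A B
    proof (rule ccontr)
      assume n: "\<not> ?thesis"
      have "\<not> P divides\<^bsub>R\<^esub> A"
      proof
        assume "P divides\<^bsub>R\<^esub> A"
        then obtain C where C: "A = P * C" by (auto simp: factor_def R)
        have "A \<noteq> 0" "B \<noteq> 0" "C \<noteq> 0" using eq P0 C by auto
        then have "degree A = degree A + degree B + degree C"
          using C eq by (metis degree_mult_eq no_zero_divisors)
        then show False using n by auto
      qed
      moreover have "A divides\<^bsub>R\<^esub> P" using eq A B by (auto simp: factor_def R)
      ultimately have "A \<in> Units R" using pf[OF A] by (auto simp: properfactor_def)
      then show False using const[of A] n by auto
    qed
    ultimately show "degree P > 0 \<and>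
      (\<forall>A\<in>polys_over F. \<forall>B\<in>polys_over F. P = A * B \<longrightarrow> degree A = 0 \<or> degree B = 0)" by auto
  next
    assume *: "degree P > 0 \<and>
      (\<forall>A\<in>polys_over F. \<forall>B\<in>polys_over F. P = A * B \<longrightarrow> degree A = 0 \<or> degree B = 0)"
    have "b \<in> Units R" if b: "b \<in> polys_over F" and "properfactor R b P" for b
    proof -
      from that obtain c where c: "c \<in> polys_over F" "P = b * c" and nd: "\<not> P divides\<^bsub>R\<^esub> b"
        by (auto simp: properfactor_def factor_def R)
      have "degree c \<noteq> 0"
      proof
        assume "degree c = 0"
        moreover have "c \<noteq> 0" using c * by auto
        ultimately have "c \<in> Units R" using const c by auto
        then obtain d where d: "d \<in> polys_over F" "c * d = 1" by (auto simp: Units_def R)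
        then have "b = P * d" using c by (simp add: mult.assoc)
        then show False using nd d b by (auto simp: factor_def R)
      qed
      then have "degree b = 0" "b \<noteq> 0" using * c b by auto
      then show ?thesis using const b by auto
    qed
    then show "ring_irreducible\<^bsub>R\<^esub> P"
      using * const[of P] by (auto simp: ring_irreducible_def Divisibility.irreducible_def R)
  qed
  then show ?thesis unfolding irreducible_over_def R_def by (rule conj_cong[OF refl])
qed

lemma irreducible_over_dvd:
  assumes F: "subfield F ambient" and irr: "irreducible_over F P" and f: "f \<in> polys_over F"
    and x: "poly P x = 0" "poly f x = 0"
  shows "P dvd f"
proof -
  have P: "P \<in> polys_over F" "degree P > 0" using irr irreducible_over_iff[OF F] by auto
  then have "algebraic_over F x" using x by (auto simp: algebraic_over_def intro!: bexI[of _ P])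
  from minimal_polynomial[OF F this] obtain m where m: "m \<in> polys_over F" "m \<noteq> 0" "degree m > 0"
    and dvd: "\<And>g. g \<in> polys_over F \<Longrightarrow> poly g x = 0 \<Longrightarrow> m dvd g" by metis
  have mP: "P = m * (P div m)" using dvd[OF P(1) x(1)] by simp
  then have "degree m = 0 \<or> degree (P div m) = 0"
    using irr m(1) polys_over_divmod(1)[OF F P(1) m(1,2)] unfolding irreducible_over_iff[OF F]
    by metis
  then have "degree (P div m) = 0" using m(3) by simp
  then obtain c where "P div m = [:c:]" by (auto elim: degree_eq_zeroE)
  then have "P = Polynomial.smult c m" "c \<noteq> 0" using mP P(2) by auto
  then show ?thesis using dvd[OF f x(2)] by (simp add: smult_dvd_iff)
qed

lemma irreducible_over_if_minimal:
  assumes F: "subfield F ambient" and P: "P \<in> polys_over F" "degree P > 0" "poly P x = 0"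
    and min: "\<And>g. g \<in> polys_over F \<Longrightarrow> g \<noteq> 0 \<Longrightarrow> poly g x = 0 \<Longrightarrow> degree P \<le> degree g"
  shows "irreducible_over F P"
  unfolding irreducible_over_iff[OF F]
proof (intro conjI ballI impI P)
  fix A B assume A: "A \<in> polys_over F" and B: "B \<in> polys_over F" and eq: "P = A * B"
  have nz: "A \<noteq> 0" "B \<noteq> 0" using eq P(2) by auto
  have "poly A x = 0 \<or> poly B x = 0" using eq P(3) by auto
  then show "degree A = 0 \<or> degree B = 0"
    using min[OF A nz(1)] min[OF B nz(2)] degree_mult_eq[OF nz] eq by auto
qed

lemma irreducible_factorization:
  assumes F: "subfield F ambient" and "P \<in> polys_over F" "P \<noteq> 0"
  shows "\<exists>c\<in>F - {0}. \<exists>Qs. (\<forall>Q\<in>set Qs. irreducible_over F Q) \<and>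
    P = Polynomial.smult c (prod_list Qs)"
  using assms(2,3)
proof (induction "degree P" arbitrary: P rule: less_induct)
  case less
  consider "degree P = 0" | "irreducible_over F P"
    | A B where "A \<in> polys_over F" "B \<in> polys_over F" "P = A * B" "degree A > 0" "degree B > 0"
    using less.prems unfolding irreducible_over_iff[OF F] by blast
  then show ?case
  proof cases
    case 1
    then obtain c where c: "P = [:c:]" by (auto elim: degree_eq_zeroE)
    then have "c \<in> F - {0}" using less.prems coeff_polys_over[of P F 0] by simp
    then show ?thesis using c by (intro bexI[of _ c] exI[of _ "[]"]) (auto simp: one_pCons)
  next
    case 2
    then show ?thesis using subfield_ambientD(2)[OF F]
      by (intro bexI[of _ 1] exI[of _ "[P]"]) auto
  next
    case 3
    then have "A \<noteq> 0" "B \<noteq> 0" by auto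
    with 3 have "degree A < degree P" "degree B < degree P" by (auto simp: degree_mult_eq)
    from less.hyps[OF this(1) 3(1) \<open>A \<noteq> 0\<close>] obtain a As where A:
      "a \<in> F - {0}" "\<forall>Q\<in>set As. irreducible_over F Q" "A = Polynomial.smult a (prod_list As)"
      by blast
    from less.hyps[OF \<open>degree B < degree P\<close> 3(2) \<open>B \<noteq> 0\<close>] obtain b Bs where B:
      "b \<in> F - {0}" "\<forall>Q\<in>set Bs. irreducible_over F Q" "B = Polynomial.smult b (prod_list Bs)"
      by blast
    from A B show ?thesis using subfield_ambientD(4)[OF F] 3(3)
      by (intro bexI[of _ "a * b"] exI[of _ "As @ Bs"]) (auto simp: mult_ac)
  qed
qed

section \<open>Finite extensions\<close>

text \<open>
  Values of polynomials suffice, without quotients: for \<open>x\<close> algebraic over \<open>F\<close> the ring \<open>F[x]\<close> is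
  already the field \<open>F(x)\<close>.
\<close>

definition adjoin :: "'a :: field set \<Rightarrow> 'a \<Rightarrow> 'a set" where
  "adjoin F x = (\<lambda>p. poly p x) ` polys_over F"

lemma eval_ambient: "ring.eval ambient ps x = poly (Poly (rev ps)) x"
proof -
  interpret field "ambient :: 'a ring" by (rule field_from_type_algebra)
  have pow: "x [^]\<^bsub>ambient\<^esub> (n :: nat) = x ^ n" for x :: 'a and n
    by (induction n) (simp_all add: mult.commute)
  show ?thesis by (induction ps) (simp_all add: pow Poly_append poly_monom algebra_simps)
qed

lemma simple_extension_ambient:
  assumes F: "subfield F ambient"
  shows "ring.simple_extension ambient F x = adjoin F x"
proof -
  interpret field "ambient :: 'a ring" by (rule field_from_type_algebra)
  have "poly p x \<in> ring.simple_extension ambient F x" if "p \<in> polys_over F" for p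
    using that
  proof (induction p)
    case 0
    show ?case using simple_extension.zero by simp
  next
    case (pCons a p)
    have "a \<in> F" using coeff_polys_over[OF pCons.prems, of 0] by simp
    moreover have "p \<in> polys_over F"
      unfolding polys_over_def using coeff_polys_over[OF pCons.prems, of "Suc _"] by simp
    ultimately show ?case
      using simple_extension.lin[OF pCons.IH, of a] by (simp add: algebra_simps)
  qed
  moreover have "y \<in> adjoin F x" if "y \<in> ring.simple_extension ambient F x" for y
    using that
  proof (induction rule: simple_extension.induct)
    case zero
    show ?case using polys_over_closed(1)[OF F] by (auto simp: adjoin_def intro!: image_eqI[of _ _ 0])
  next
    case (lin y a)
    then obtain p where "p \<in> polys_over F" "y = poly p x" by (auto simp: adjoin_def)
    then show ?case using lin polys_over_closed(8)[OF F]
      by (auto simp: adjoin_def algebra_simps intro!: image_eqI[of _ _ "pCons a p"])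
  qed
  ultimately show ?thesis by (auto simp: adjoin_def)
qed

lemma subset_adjoin:
  assumes "subfield F ambient"
  shows "F \<subseteq> adjoin F x" "x \<in> adjoin F x"
proof -
  have "[:c:] \<in> polys_over F" if "c \<in> F" for c
    using that by (intro polys_over_closed[OF assms])
  then show "F \<subseteq> adjoin F x" by (force simp: adjoin_def)
  have "[:0, 1:] \<in> polys_over F"
    by (intro polys_over_closed[OF assms] subfield_ambientD[OF assms])
  then show "x \<in> adjoin F x" by (force simp: adjoin_def)
qed

lemma adjoin_subset:
  assumes "subfield E ambient" "F \<subseteq> E" "x \<in> E"
  shows "adjoin F x \<subseteq> E"
  using poly_in_subfield[OF assms(1) _ assms(3)] polys_over_mono[OF assms(2)]
  by (auto simp: adjoin_def)

lemma finite_extension_adjoin: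
  assumes F: "subfield F ambient" and x: "algebraic_over F x"
  shows "finite_extension F (adjoin F x)"
proof -
  interpret field "ambient :: 'a ring" by (rule field_from_type_algebra)
  from x obtain p where p: "p \<in> polys_over F" "p \<noteq> 0" "poly p x = 0"
    by (auto simp: algebraic_over_def)
  have "ring.algebraic ambient F x"
  proof (rule algebraicI[unfolded over_def])
    have "set (coeffs p) \<subseteq> F" using p(1) by (auto simp: coeffs_def polys_over_def)
    moreover have "last (coeffs p) \<noteq> 0" using p(2) last_coeffs_eq_coeff_degree[of p] by simp
    ultimately show "rev (coeffs p) \<in> carrier (univ_poly ambient F)"
      unfolding univ_poly_carrier[symmetric] polynomial_def using p(2) by (simp add: hd_rev)
  qed (use p in \<open>simp_all add: eval_ambient\<close>)
  then show ?thesis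
    unfolding finite_extension_def
    using F simple_extension_is_subfield[OF F, of x] finite_dimension_simple_extension[OF F, of x]
      subset_adjoin[OF F, of x] by (simp add: simple_extension_ambient[OF F] over_def)
qed

lemma finite_extension_refl:
  assumes "subfield F ambient"
  shows "finite_extension F F"
proof -
  interpret field "ambient :: 'a ring" by (rule field_from_type_algebra)
  show ?thesis
    using assms finite_dimensionI[OF dimension_one[OF assms]] by (simp add: finite_extension_def)
qed

lemma finite_extension_trans:
  assumes "finite_extension F E" "finite_extension E L"
  shows "finite_extension F L"
proof -
  interpret field "ambient :: 'a ring" by (rule field_from_type_algebra)
  show ?thesis
    using assms telescopic_base_dim(1)[of F E L] by (auto simp: finite_extension_def)
qed

text \<open>
  Translates linear combinations of the powers of \<open>x\<close> into values of polynomials. The shift by \<open>j\<close> is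
  what the induction needs.
\<close>

lemma combine_powers:
  fixes x :: "'a :: field"
  shows "ring.combine ambient Ks (map (\<lambda>i. x ^ (i + j)) [0..<length Ks]) = x ^ j * poly (Poly Ks) x"
proof -
  interpret field "ambient :: 'a ring" by (rule field_from_type_algebra)
  show ?thesis
  proof (induction Ks arbitrary: j)
    case (Cons a Ks)
    have "map (\<lambda>i. x ^ (i + j)) [0..<length (a # Ks)]
        = x ^ j # map (\<lambda>i. x ^ (i + Suc j)) [0..<length Ks]"
      by (simp add: upt_conv_Cons map_Suc_upt[symmetric] del: upt_Suc)
    then show ?case using Cons.IH[of "Suc j"] by (simp add: algebra_simps del: upt_Suc)
  qed simp
qed

text \<open>
  In dimension \<open>n\<close> the \<open>n + 1\<close> powers \<open>1, x, \<dots>, x ^ n\<close> are linearly dependent. The bound does not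
  depend on \<open>x\<close>, which matters for the finiteness argument in number fields.
\<close>

lemma finite_extension_bounded_degree:
  assumes "finite_extension F E"
  obtains n where "\<And>x. x \<in> E \<Longrightarrow> \<exists>p\<in>polys_over F. p \<noteq> 0 \<and> degree p \<le> n \<and> poly p x = 0"
proof -
  interpret field "ambient :: 'a ring" by (rule field_from_type_algebra)
  from assms obtain n where F: "subfield F ambient" and E: "subfield E ambient" and
    n: "ring.dimension ambient n F E"
    by (auto simp: finite_extension_def finite_dimension_def)
  have "\<exists>p\<in>polys_over F. p \<noteq> 0 \<and> degree p \<le> n \<and> poly p x = 0" if x: "x \<in> E" for x
  proof -
    define Us where "Us = map (\<lambda>i. x ^ (i + 0)) [0..<Suc n]"
    have Us: "set Us \<subseteq> E" using subfield_ambientD(9)[OF E x] by (auto simp: Us_def)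
    have "ring.dependent ambient F Us"
    proof (rule ccontr)
      assume "\<not> ?thesis"
      then have "length Us \<le> n" by (intro independent_length_le_dimension[OF F n _ Us]) auto
      then show False by (simp add: Us_def)
    qed
    then obtain Ks where Ks: "length Ks = length Us" "ring.combine ambient Ks Us = 0"
      "set Ks \<subseteq> F" "set Ks \<noteq> {0}"
      using dependent_imp_non_trivial_combine[OF F, of Us] by auto
    have len: "length Ks = Suc n" using Ks(1) by (simp add: Us_def)
    have "poly (Poly Ks) x = 0"
      using combine_powers[of Ks x 0] Ks(2) len by (simp add: Us_def del: upt_Suc)
    moreover have "Poly Ks \<noteq> 0"
    proof
      assume "Poly Ks = 0"
      then obtain k where k: "Ks = replicate k 0" using Poly_eq_0 by blast
      then have "k = Suc n" using len by simp
      then have "set Ks = {0}" using k set_replicate[of "Suc n" "0 :: 'a"] by simp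
      then show False using Ks(4) by simp
    qed
    moreover have "Poly Ks \<in> polys_over F"
      using Ks(3) subfield_ambientD(1)[OF F]
      by (auto simp: polys_over_def coeff_Poly_eq nth_default_def)
    moreover have "degree (Poly Ks) \<le> n"
    proof -
      have "length (coeffs (Poly Ks)) \<le> Suc n"
        using len length_strip_while_le[of "(=) 0" Ks] by simp
      then show ?thesis using \<open>Poly Ks \<noteq> 0\<close> by (simp add: length_coeffs_degree del: coeffs_Poly)
    qed
    ultimately show ?thesis by blast
  qed
  then show ?thesis using that by blast
qed

lemma finite_extension_algebraic:
  "finite_extension F E \<Longrightarrow> x \<in> E \<Longrightarrow> algebraic_over F x"
  using finite_extension_bounded_degree by (metis algebraic_over_def)

text \<open>
  A basis of \<open>E\<close> over \<open>F\<close> generates \<open>E\<close>. A condition that defines a subfield needs to be checked only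
  on \<open>F\<close> and on these finitely many elements.
\<close>

lemma finite_extension_generators:
  assumes "finite_extension F E"
  obtains xs where "set xs \<subseteq> E"
    "\<And>M. subfield M ambient \<Longrightarrow> F \<subseteq> M \<Longrightarrow> set xs \<subseteq> M \<Longrightarrow> E \<subseteq> M"
proof -
  interpret field "ambient :: 'a ring" by (rule field_from_type_algebra)
  from assms obtain n where F: "subfield F ambient" and E: "subfield E ambient" and
    n: "ring.dimension ambient n F E"
    by (auto simp: finite_extension_def finite_dimension_def)
  from exists_base[OF F n] obtain xs where span: "ring.Span ambient F xs = E" by auto
  have "ring.combine ambient Ks xs \<in> M"
    if "subfield M ambient" "set xs \<subseteq> M" "set Ks \<subseteq> M" for M Ks
    using that(2,3)
    by (induction Ks xs rule: combine.induct) (auto simp: subfield_ambientD[OF that(1)])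
  then have "E \<subseteq> M" if "subfield M ambient" "F \<subseteq> M" "set xs \<subseteq> M" for M
    using that span Span_eq_combine_set[OF F, of xs] by auto
  moreover have "set xs \<subseteq> E" using span Span_base_incl[OF F, of xs] by auto
  ultimately show ?thesis using that by blast
qed

lemma algebraic_over_mono: "F \<subseteq> E \<Longrightarrow> algebraic_over F x \<Longrightarrow> algebraic_over E x"
  using polys_over_mono[of F E] unfolding algebraic_over_def by blast

lemma finite_extension_adjoin_set:
  assumes "subfield F ambient" "finite S" "\<And>x. x \<in> S \<Longrightarrow> algebraic_over F x"
  obtains E where "finite_extension F E" "S \<subseteq> E"
proof -
  have "\<exists>E. finite_extension F E \<and> S \<subseteq> E"
    using assms(2,3)
  proof (induction S rule: finite_induct)
    case empty
    show ?case using finite_extension_refl[OF assms(1)] by auto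
  next
    case (insert x S)
    then obtain E where E: "finite_extension F E" "S \<subseteq> E" by auto
    then have sE: "subfield E ambient" "F \<subseteq> E" by (auto simp: finite_extension_def)
    then have "finite_extension E (adjoin E x)"
      using insert.prems algebraic_over_mono finite_extension_adjoin by blast
    then show ?case
      using E finite_extension_trans subset_adjoin[OF sE(1), of x] by blast
  qed
  then show ?thesis using that by blast
qed

lemma subfield_algebraic_over:
  assumes F: "subfield F ambient"
  shows "subfield {x. algebraic_over F x} ambient"
proof -
  have *: "\<exists>E. subfield E ambient \<and> x \<in> E \<and> y \<in> E \<and> E \<subseteq> {x. algebraic_over F x}"
    if xy: "algebraic_over F x" "algebraic_over F y" for x y
  proof -
    obtain E where "finite_extension F E" "{x, y} \<subseteq> E"
      using finite_extension_adjoin_set[OF F, of "{x, y}"] xy by auto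
    then show ?thesis using finite_extension_algebraic
      by (intro exI[of _ E]) (auto simp: finite_extension_def)
  qed
  have one: "algebraic_over F 1"
    using finite_extension_algebraic[OF finite_extension_refl[OF F]] subfield_ambientD(2)[OF F] .
  show ?thesis
  proof (rule subfield_ambientI)
    fix x assume x: "x \<in> {x. algebraic_over F x}"
    with *[of x x] obtain E where E: "subfield E ambient" "x \<in> E" "E \<subseteq> {x. algebraic_over F x}"
      by auto
    then show "- x \<in> {x. algebraic_over F x}" "inverse x \<in> {x. algebraic_over F x}"
      using subfield_ambientD(5,7)[OF E(1)] by auto
    fix y assume "y \<in> {x. algebraic_over F x}"
    with x *[of x y] obtain E where E: "subfield E ambient" "x \<in> E" "y \<in> E"
      "E \<subseteq> {x. algebraic_over F x}" by auto
    then show "x + y \<in> {x. algebraic_over F x}" "x * y \<in> {x. algebraic_over F x}"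
      using subfield_ambientD(3,4)[OF E(1), of x y] by auto
  qed (use one in simp)
qed

text \<open>
  Only the finitely many coefficients of a polynomial over \<open>E\<close> are involved, so \<open>x\<close> is algebraic already
  over a finite extension of \<open>F\<close>.
\<close>

lemma algebraic_over_trans:
  assumes F: "subfield F ambient" and E: "subfield E ambient" "\<And>c. c \<in> E \<Longrightarrow> algebraic_over F c"
    and x: "algebraic_over E x"
  shows "algebraic_over F x"
proof -
  from x obtain p where p: "p \<in> polys_over E" "p \<noteq> 0" "poly p x = 0"
    by (auto simp: algebraic_over_def)
  have "set (coeffs p) \<subseteq> E" using p(1) by (auto simp: coeffs_def polys_over_def)
  then have "algebraic_over F c" if "c \<in> set (coeffs p)" for c using that E(2) by blast
  then obtain M where M: "finite_extension F M" "set (coeffs p) \<subseteq> M"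
    using finite_extension_adjoin_set[OF F finite_set] by metis
  then have sM: "subfield M ambient" by (simp add: finite_extension_def)
  have "p \<in> polys_over M"
  proof -
    have "poly.coeff p i \<in> insert 0 (set (coeffs p))" for i
      unfolding range_coeff[symmetric] by (rule rangeI)
    moreover have "insert 0 (set (coeffs p)) \<subseteq> M"
      using M(2) subfield_ambientD(1)[OF sM] by simp
    ultimately have "poly.coeff p i \<in> M" for i by (rule set_mp[rotated])
    then show ?thesis by (simp add: polys_over_def)
  qed
  then have "finite_extension M (adjoin M x)"
    using p by (intro finite_extension_adjoin[OF sM]) (auto simp: algebraic_over_def)
  then show ?thesis
    by (rule finite_extension_algebraic[OF finite_extension_trans[OF M(1)] subset_adjoin(2)[OF sM]])
qed

section \<open>Hereditary irreducibility\<close>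

lemma power_gcd_mem:
  fixes y :: "'a :: field"
  assumes E: "subfield E ambient" and "y ^ m \<in> E" "y ^ d \<in> E" "d > 0" "y \<noteq> 0"
  shows "y ^ gcd d m \<in> E"
proof -
  obtain a b where ab: "d * a = m * b + gcd d m"
    using bezout_nat[of d m] assms(4) by auto
  have "y ^ gcd d m = (y ^ d) ^ a / (y ^ m) ^ b"
    using assms(5) ab by (simp add: power_mult[symmetric] power_add)
  then show ?thesis using assms by (auto intro!: subfield_ambientD[OF E])
qed

text \<open>
  The constant term of a monic polynomial is, up to sign, the product of its roots; here all roots have
  the same \<open>m\<close>-th power.
\<close>

lemma constant_term_power:
  fixes f :: "'a :: alg_closed_field poly"
  assumes "f \<noteq> 0" and "\<And>x. poly f x = 0 \<Longrightarrow> x ^ m = c"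
  shows "(poly f 0 / lead_coeff f) ^ m = ((- 1) ^ m * c) ^ degree f"
proof -
  obtain A where A: "size A = degree f" "f = Polynomial.smult (lead_coeff f) (\<Prod>x\<in>#A. [:- x, 1:])"
    using alg_closed_imp_factorization[OF assms(1)] by metis
  have lc: "lead_coeff f \<noteq> 0" using assms(1) by simp
  have pf: "poly f y = lead_coeff f * (\<Prod>x\<in>#A. y - x)" for y
    by (subst A(2)) (simp add: poly_prod_mset image_mset.compositionality o_def)
  have roots: "x ^ m = c" if "x \<in># A" for x
  proof (rule assms(2))
    have "0 \<in># image_mset (\<lambda>z. x - z) A" using that by force
    then show "poly f x = 0" unfolding pf by (simp add: prod_mset_zero_iff)
  qed
  have "(\<Prod>x\<in>#A. - x) ^ m = ((- 1) ^ m * c) ^ size A"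
    using roots
  proof (induction A)
    case (add x A)
    have "(- x) ^ m = (- 1) ^ m * c" using add.prems[of x] by (subst power_minus) simp
    then have "(- x) ^ m * (\<Prod>x\<in>#A. - x) ^ m = ((- 1) ^ m * c) ^ size (add_mset x A)"
      using add by simp
    then show ?case
      by (simp only: image_mset_add_mset prod_mset.add_mset power_mult_distrib)
  qed simp
  then show ?thesis using pf[of 0] lc A(1) by simp
qed

text \<open>
  The degree of a radical in Kummer theory, without Galois groups. The roots of the minimal polynomial
  \<open>h\<close> of \<open>y\<close> differ from \<open>y\<close> by roots of unity, which lie in \<open>E\<close>; comparing with the constant term of
  \<open>h\<close> shows \<open>y ^ d \<in> E\<close> for \<open>d = degree h\<close>. If \<open>d < m\<close>, then \<open>y ^ gcd d m \<in> E\<close> exhibits \<open>y ^ m\<close> as a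
  proper power in \<open>E\<close>.
\<close>

lemma degree_over_field_with_roots_of_unity:
  fixes y :: "'a :: alg_closed_field"
  assumes E: "subfield E ambient" and mu: "\<And>\<zeta>. root_of_unity \<zeta> \<Longrightarrow> \<zeta> \<in> E"
    and y: "y ^ m \<in> E" "y \<noteq> 0" "m > 0"
    and nopow: "\<And>p x. Factorial_Ring.prime p \<Longrightarrow> x \<in> E \<Longrightarrow> x ^ p \<noteq> y ^ m"
    and f: "f \<in> polys_over E" "f \<noteq> 0" "poly f y = 0"
  shows "m \<le> degree f"
proof -
  have "algebraic_over E y" using f by (auto simp: algebraic_over_def)
  from minimal_polynomial[OF E this] obtain h where h: "h \<in> polys_over E" "h \<noteq> 0"
    "poly h y = 0" "degree h > 0" and dvd: "\<And>g. g \<in> polys_over E \<Longrightarrow> poly g y = 0 \<Longrightarrow> h dvd g"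
    by metis
  define d where "d = degree h"
  have "Polynomial.monom 1 m - [:y ^ m:] \<in> polys_over E"
    by (intro polys_over_closed[OF E] subfield_ambientD[OF E] y)
  then have "h dvd Polynomial.monom 1 m - [:y ^ m:]"
    by (rule dvd) (simp add: poly_monom)
  then have roots: "x ^ m = y ^ m" if "poly h x = 0" for x
    using that by (auto simp: poly_monom elim!: dvdE dest!: arg_cong[of _ _ "\<lambda>p. poly p x"])
  define w where "w = poly h 0 / lead_coeff h"
  have w: "w \<in> E"
    unfolding w_def using h coeff_polys_over[OF h(1)]
    by (intro subfield_ambientD[OF E] poly_in_subfield[OF E])
  have wm: "w ^ m = ((- 1) ^ m * y ^ m) ^ d"
    unfolding w_def d_def using roots by (intro constant_term_power h(2))
  \<comment> \<open>the exponent is doubled because the sign in \<open>wm\<close> is only a square root of \<open>1\<close>\<close>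
  have "(w / y ^ d) ^ (2 * m) = ((w ^ m) / (y ^ m) ^ d) ^ 2"
    by (simp add: power_divide power_mult[symmetric] mult_ac)
  also have "\<dots> = 1"
    using y(2) unfolding wm
    by (simp add: power_mult_distrib) (simp add: power_mult[symmetric] uminus_power_if)
  finally have "root_of_unity (w / y ^ d)" using y(3)
    by (auto simp: root_of_unity_def intro!: exI[of _ "2 * m"])
  then have "w / y ^ d \<in> E" by (rule mu)
  moreover have "w ^ m \<noteq> 0" using wm y(2) by simp
  then have "w \<noteq> 0" using y(3) by auto
  ultimately have "y ^ d \<in> E"
    using subfield_ambientD(8)[OF E w, of "w / y ^ d"] by simp
  have "\<not> d < m"
  proof
    assume "d < m"
    define g where "g = gcd d m"
    have "d > 0" using h(4) by (simp add: d_def)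
    then have g: "y ^ g \<in> E"
      unfolding g_def using power_gcd_mem[OF E y(1) \<open>y ^ d \<in> E\<close>] y(2) by blast
    have "g \<le> d" using \<open>d > 0\<close> by (auto simp: g_def intro: dvd_imp_le)
    moreover obtain q where q: "m = g * q" unfolding g_def using gcd_dvd2[of d m] by (metis dvdE)
    ultimately have "q \<noteq> 1" using \<open>d < m\<close> by auto
    then obtain p t where "Factorial_Ring.prime p" "q = p * t" using prime_factor_nat by (metis dvdE)
    then have "(y ^ (g * t)) ^ p = y ^ m" using q by (simp add: power_mult[symmetric] mult_ac)
    moreover have "y ^ (g * t) \<in> E" using g by (auto simp: power_mult intro!: subfield_ambientD[OF E])
    ultimately show False using nopow \<open>Factorial_Ring.prime p\<close> by blast
  qed
  moreover have "degree h \<le> degree f" using dvd[OF f(1,3)] f(2) by (rule dvd_imp_degree_le)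
  ultimately show ?thesis by (simp add: d_def)
qed

lemma subst_power_polys_over:
  assumes F: "subfield F ambient" and "P \<in> polys_over F"
  shows "subst_power n P \<in> polys_over F"
  using assms(2) unfolding subst_power_def
proof (induction P)
  case 0
  show ?case using polys_over_closed(1)[OF F] by simp
next
  case (pCons a p)
  have "a \<in> F" using coeff_polys_over[OF pCons.prems, of 0] by simp
  moreover have "p \<in> polys_over F"
    unfolding polys_over_def using coeff_polys_over[OF pCons.prems, of "Suc _"] by simp
  ultimately show ?case using pCons.IH
    by (auto simp: pcompose_pCons intro!: polys_over_closed[OF F] subfield_ambientD[OF F])
qed

lemma poly_subst_power [simp]: "poly (subst_power n P) x = poly P (x ^ n)"
  by (simp add: subst_power_def poly_pcompose poly_monom)

lemma degree_subst_power [simp]: "degree (subst_power n P) = n * degree P"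
  by (simp add: subst_power_def degree_pcompose degree_monom_eq)

lemma subst_power_subst_power: "subst_power m (subst_power n P) = subst_power (n * m) P"
proof -
  have "pcompose (Polynomial.monom 1 n) (Polynomial.monom (1 :: 'a) m) = Polynomial.monom 1 (n * m)"
    by (induction n) (auto simp: monom_Suc pcompose_pCons monom_0 mult_monom one_pCons)
  then show ?thesis by (simp add: subst_power_def pcompose_assoc[symmetric])
qed

text \<open>
  Groups the exponents of \<open>A\<close> by their residue modulo \<open>m\<close>: \<open>A\<close> is a sum of terms
  \<open>A\<^sub>i(x^m) * x^i\<close> with \<open>i < m\<close>.
\<close>

lemma poly_blocks:
  fixes A :: "'a :: comm_semiring_1 poly"
  assumes "degree A < m * d"
  shows "poly A y = (\<Sum>i<m. (\<Sum>j<d. poly.coeff A (i + j * m) * (y ^ m) ^ j) * y ^ i)"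
proof -
  have "poly A y = (\<Sum>l<d * m. poly.coeff A l * y ^ l)"
    unfolding poly_altdef using assms
    by (intro sum.mono_neutral_left) (auto simp: coeff_eq_0 mult.commute)
  also have "\<dots> = (\<Sum>j<d. \<Sum>l=j*m..<j*m+m. poly.coeff A l * y ^ l)"
    by (rule sum.nat_group[symmetric])
  also have "\<dots> = (\<Sum>j<d. \<Sum>i<m. poly.coeff A (i + j * m) * y ^ (i + j * m))"
  proof (rule sum.cong[OF refl])
    fix j
    show "(\<Sum>l=j*m..<j*m+m. poly.coeff A l * y ^ l) = (\<Sum>i<m. poly.coeff A (i + j * m) * y ^ (i + j * m))"
      using sum.shift_bounds_nat_ivl[of "\<lambda>l. poly.coeff A l * y ^ l" 0 "j * m" m]
      by (simp add: add.commute lessThan_atLeast0)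
  qed
  also have "\<dots> = (\<Sum>i<m. \<Sum>j<d. poly.coeff A (i + j * m) * y ^ (i + j * m))"
    by (rule sum.swap)
  also have "\<dots> = (\<Sum>i<m. (\<Sum>j<d. poly.coeff A (i + j * m) * (y ^ m) ^ j) * y ^ i)"
    by (simp add: sum_distrib_right sum_distrib_left power_add power_mult[symmetric] mult_ac)
  finally show ?thesis .
qed

text \<open>
  The tower \<open>F \<subseteq> F(\<gamma>) \<subseteq> F(y)\<close> with \<open>y ^ m = \<gamma>\<close> has degrees \<open>degree Q\<close> and \<open>m\<close>, so that
  \<open>Q(x^m)\<close> has the least degree possible for a polynomial over \<open>F\<close> vanishing at \<open>y\<close>. Multiplicativity of
  degrees is unfolded here: a polynomial of smaller degree vanishing at \<open>y\<close> splits into blocks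
  \<open>A\<^sub>i(x^m) * x^i\<close>, the degree of the upper step forces
  \<open>A\<^sub>i(\<gamma>) = 0\<close>, and that of the lower one \<open>A\<^sub>i = 0\<close>.
\<close>

lemma irreducible_subst_power:
  fixes F :: "'a :: alg_closed_field set"
  assumes F: "subfield F ambient" and mu: "\<And>\<zeta>. root_of_unity \<zeta> \<Longrightarrow> \<zeta> \<in> F"
    and Q: "irreducible_over F Q" "poly Q \<gamma> = 0" "\<gamma> \<noteq> 0"
    and nopow: "\<And>p x. Factorial_Ring.prime p \<Longrightarrow> x \<in> adjoin F \<gamma> \<Longrightarrow> x ^ p \<noteq> \<gamma>"
    and m: "m > 0"
  shows "irreducible_over F (subst_power m Q)"
proof -
  have Qp: "Q \<in> polys_over F" and dQ: "degree Q > 0" using Q(1) irreducible_over_iff[OF F] by auto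
  define d where "d = degree Q"
  have "algebraic_over F \<gamma>" using Qp dQ Q(2) by (auto simp: algebraic_over_def intro!: bexI[of _ Q])
  then have "finite_extension F (adjoin F \<gamma>)" by (rule finite_extension_adjoin[OF F])
  then have E: "subfield (adjoin F \<gamma>) ambient" by (simp add: finite_extension_def)
  obtain y where y: "y ^ m = \<gamma>" using m by (metis nth_root_exists)
  have y0: "y \<noteq> 0" using y Q(3) m by auto
  show ?thesis
  proof (rule irreducible_over_if_minimal[OF F, of _ y])
    show "subst_power m Q \<in> polys_over F" by (rule subst_power_polys_over[OF F Qp])
    show "degree (subst_power m Q) > 0" "poly (subst_power m Q) y = 0"
      using dQ m y Q(2) by auto
    fix A assume A: "A \<in> polys_over F" "A \<noteq> 0" "poly A y = 0"
    show "degree (subst_power m Q) \<le> degree A"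
    proof (rule ccontr)
      assume "\<not> ?thesis"
      then have lt: "degree A < m * d" by (simp add: d_def)
      define a where "a i = (\<Sum>j<d. Polynomial.monom (poly.coeff A (i + j * m)) j)" for i
      have a: "a i \<in> polys_over F" for i
        unfolding a_def using coeff_polys_over[OF A(1)]
        by (induction d) (auto intro!: polys_over_closed[OF F])
      have coeff_a: "poly.coeff (a i) j = (if j < d then poly.coeff A (i + j * m) else 0)" for i j
        by (simp add: a_def coeff_sum when_def if_distrib cong: if_cong)
      have poly_a: "poly (a i) \<gamma> = (\<Sum>j<d. poly.coeff A (i + j * m) * (y ^ m) ^ j)" for i
        by (simp add: a_def poly_sum poly_monom y)
      \<comment> \<open>\<open>B\<close> is a polynomial over \<open>F(\<gamma>)\<close> of degree less than \<open>m\<close> with the same value at \<open>y\<close> as \<open>A\<close>\<close>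
      define B where "B = (\<Sum>i<m. Polynomial.monom (poly (a i) \<gamma>) i)"
      have coeff_B: "poly.coeff B i = (if i < m then poly (a i) \<gamma> else 0)" for i
        by (simp add: B_def coeff_sum if_distrib cong: if_cong)
      have "poly B y = poly A y"
        unfolding poly_blocks[OF lt] B_def by (simp add: poly_sum poly_monom poly_a)
      then have "poly B y = 0" using A(3) by simp
      moreover have "B \<in> polys_over (adjoin F \<gamma>)"
        using subfield_ambientD(1)[OF E] a by (auto simp: polys_over_def coeff_B adjoin_def)
      moreover have "degree B < m" using m by (auto simp: degree_lessI coeff_B)
      moreover have "\<zeta> \<in> adjoin F \<gamma>" if "root_of_unity \<zeta>" for \<zeta>
        using mu[OF that] subset_adjoin(1)[OF F] by blast
      ultimately have "B = 0"
        using degree_over_field_with_roots_of_unity[OF E, of y m B] y y0 m nopow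
          subset_adjoin(2)[OF F, of \<gamma>] by auto
      have "a i = 0" if "i < m" for i
      proof (rule ccontr)
        assume "a i \<noteq> 0"
        have "poly (a i) \<gamma> = 0" using \<open>B = 0\<close> coeff_B[of i] that by simp
        then have "Q dvd a i" by (rule irreducible_over_dvd[OF F Q(1) a Q(2)])
        then have "d \<le> degree (a i)" using \<open>a i \<noteq> 0\<close> by (auto simp: d_def dvd_imp_degree_le)
        moreover have "degree (a i) < d" using dQ by (auto simp: degree_lessI coeff_a d_def)
        ultimately show False by simp
      qed
      then have "poly.coeff A (i + j * m) = 0" if "i < m" "j < d" for i j
        using coeff_a[of i j] that by simp
      from this[of "degree A mod m" "degree A div m"] have "lead_coeff A = 0"
        using m lt by (simp add: less_mult_imp_div_less mult.commute)
      then show False using A(2) by simp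
    qed
  qed
qed

lemma irreducible_over_smult:
  assumes F: "subfield F ambient" and "c \<in> F" "c \<noteq> 0" "irreducible_over F P"
  shows "irreducible_over F (Polynomial.smult c P)"
proof -
  have P: "P \<in> polys_over F" "degree P > 0" and irr:
    "\<And>A B. A \<in> polys_over F \<Longrightarrow> B \<in> polys_over F \<Longrightarrow> P = A * B \<Longrightarrow> degree A = 0 \<or> degree B = 0"
    using assms(4) unfolding irreducible_over_iff[OF F] by (blast, blast, metis)
  show ?thesis
    unfolding irreducible_over_iff[OF F]
  proof (intro conjI ballI impI)
    show "Polynomial.smult c P \<in> polys_over F" using P assms(2) by (intro polys_over_closed[OF F])
    show "degree (Polynomial.smult c P) > 0" using P assms(3) by simp
    fix A B assume A: "A \<in> polys_over F" and B: "B \<in> polys_over F"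
      and eq: "Polynomial.smult c P = A * B"
    have "P = Polynomial.smult (inverse c) (Polynomial.smult c P)" using assms(3) by simp
    also have "\<dots> = Polynomial.smult (inverse c) A * B" unfolding eq by simp
    finally have "degree (Polynomial.smult (inverse c) A) = 0 \<or> degree B = 0"
      using A B assms(2) by (intro irr polys_over_closed[OF F] subfield_ambientD[OF F])
    then show "degree A = 0 \<or> degree B = 0" using assms(3) by simp
  qed
qed

lemma irreducible_over_unique:
  assumes F: "subfield F ambient" and P: "irreducible_over F P" and Q: "irreducible_over F Q"
    and x: "poly P x = 0" "poly Q x = 0"
  obtains c where "c \<in> F" "c \<noteq> 0" "Q = Polynomial.smult c P"
proof -
  have Pp: "P \<in> polys_over F" "P \<noteq> 0" and Qp: "Q \<in> polys_over F" "Q \<noteq> 0"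
    using P Q irreducible_over_iff[OF F] by auto
  have "P dvd Q" "Q dvd P"
    using irreducible_over_dvd[OF F P Qp(1) x] irreducible_over_dvd[OF F Q Pp(1) x(2,1)] by auto
  then obtain R where R: "Q = P * R" by auto
  have "degree Q \<le> degree P" using \<open>Q dvd P\<close> Pp(2) by (rule dvd_imp_degree_le)
  moreover have "R \<noteq> 0" using R Qp(2) by auto
  ultimately have "degree R = 0" using R Pp(2) by (simp add: degree_mult_eq)
  then obtain c where "R = [:c:]" by (auto elim: degree_eq_zeroE)
  then have c: "Q = Polynomial.smult c P" using R by simp
  then have "lead_coeff Q / lead_coeff P = c" using Pp(2) by simp
  moreover have "lead_coeff Q / lead_coeff P \<in> F"
    using coeff_polys_over[OF Pp(1)] coeff_polys_over[OF Qp(1)] by (intro subfield_ambientD[OF F])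
  ultimately show ?thesis using that[of c] c Qp(2) by auto
qed

lemma prod_list_root:
  fixes Qs :: "'a :: field poly list"
  shows "Q \<in> set Qs \<Longrightarrow> poly Q x = 0 \<Longrightarrow> poly (prod_list Qs) x = 0"
  by (induction Qs) auto

text \<open>
  Let \<open>\<delta>\<close> be a root of an irreducible factor \<open>Q\<close> of \<open>P(x^N)\<close>, so that \<open>\<alpha> = \<delta> ^ N\<close> is a root of \<open>P\<close>,
  and write \<open>N = n * t\<close> with \<open>n\<close> maximal for \<open>\<alpha>\<close>. Then \<open>\<gamma> = \<delta> ^ t\<close> lies in \<open>F(\<alpha>)\<close> and, by maximality,
  is not a proper power in \<open>F(\<gamma>)\<close>. Hence \<open>R(x^t)\<close> is irreducible for the minimal polynomial \<open>R\<close> of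
  \<open>\<gamma>\<close>; it vanishes at \<open>\<delta>\<close>, so it equals \<open>Q\<close> up to a constant, and \<open>Q\<close> inherits the hereditary
  irreducibility of \<open>R\<close>.
\<close>

theorem good_heredity_if_roots_bounded:
  fixes F :: "'a :: alg_closed_field set"
  assumes F: "subfield F ambient" and mu: "\<And>\<zeta>. root_of_unity \<zeta> \<Longrightarrow> \<zeta> \<in> F"
    and bounded: "\<And>\<alpha>. algebraic_over F \<alpha> \<Longrightarrow> \<alpha> \<noteq> 0 \<Longrightarrow> \<not> root_of_unity \<alpha> \<Longrightarrow>
      finite {n. n \<ge> 1 \<and> (\<exists>x\<in>adjoin F \<alpha>. x ^ n = \<alpha>)}"
  shows "field_has_good_heredity F"
  unfolding field_has_good_heredity_def
proof (intro ballI impI)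
  fix P assume P: "P \<in> polys_over F"
    and roots: "\<forall>\<alpha>. algebraic_over F \<alpha> \<and> poly P \<alpha> = 0 \<longrightarrow> \<alpha> \<noteq> 0 \<and> \<not> root_of_unity \<alpha>"
  have "P \<noteq> 0"
  proof
    assume "P = 0"
    then show False
      using roots[rule_format, of 0]
        finite_extension_algebraic[OF finite_extension_refl[OF F] subfield_ambientD(1)[OF F]]
      by simp
  qed
  then have alg: "algebraic_over F \<alpha>" if "poly P \<alpha> = 0" for \<alpha>
    using that P by (auto simp: algebraic_over_def)
  define S where "S \<alpha> = {n. n \<ge> 1 \<and> (\<exists>x\<in>adjoin F \<alpha>. x ^ n = \<alpha>)}" for \<alpha>
  have S: "finite (S \<alpha>)" "1 \<in> S \<alpha>" if "poly P \<alpha> = 0" for \<alpha>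
  proof -
    show "finite (S \<alpha>)"
      unfolding S_def using alg[OF that] roots[rule_format, of \<alpha>] that
      by (intro bounded) simp_all
    show "1 \<in> S \<alpha>" using subset_adjoin(2)[OF F, of \<alpha>] by (simp add: S_def)
  qed
  define N where "N = (\<Prod>\<alpha> | poly P \<alpha> = 0. Max (S \<alpha>))"
  have "Max (S \<alpha>) \<ge> 1" if "poly P \<alpha> = 0" for \<alpha> using Max_ge S[OF that] by blast
  then have N: "N \<ge> 1" unfolding N_def by (intro prod_ge_1) auto
  define PN where "PN = subst_power N P"
  have "PN \<in> polys_over F" unfolding PN_def by (rule subst_power_polys_over[OF F P])
  moreover have "PN \<noteq> 0"
    using \<open>P \<noteq> 0\<close> N by (simp add: PN_def subst_power_def pcompose_eq_0_iff degree_monom_eq)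
  ultimately obtain c Qs where c: "c \<in> F - {0}" and Qs: "\<forall>Q\<in>set Qs. irreducible_over F Q"
    and PN: "PN = Polynomial.smult c (prod_list Qs)"
    using irreducible_factorization[OF F] by blast
  have "hereditarily_irreducible F Q" if "Q \<in> set Qs" for Q
  proof -
    have irr: "irreducible_over F Q" using Qs that by blast
    then have Q: "Q \<in> polys_over F" "degree Q > 0" using irreducible_over_iff[OF F] by auto
    then obtain \<delta> where \<delta>: "poly Q \<delta> = 0" using alg_closed_imp_poly_has_root by blast
    then have "poly PN \<delta> = 0" using PN prod_list_root[OF that] by simp
    define \<alpha> where "\<alpha> = \<delta> ^ N"
    have \<alpha>: "poly P \<alpha> = 0" using \<open>poly PN \<delta> = 0\<close> by (simp add: PN_def \<alpha>_def)
    define n where "n = Max (S \<alpha>)"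
    have "n \<in> S \<alpha>" unfolding n_def using S[OF \<alpha>] by (intro Max_in) auto
    then obtain \<beta> where n: "n \<ge> 1" and \<beta>: "\<beta> \<in> adjoin F \<alpha>" "\<beta> ^ n = \<alpha>" by (auto simp: S_def)
    have "n dvd N" unfolding n_def N_def
      using \<open>P \<noteq> 0\<close> \<alpha> poly_roots_finite by (intro dvd_prodI) auto
    then obtain t where t: "N = n * t" by (rule dvdE)
    have "t > 0" using N t by (cases "t = 0") auto
    define \<gamma> where "\<gamma> = \<delta> ^ t"
    have \<gamma>n: "\<gamma> ^ n = \<alpha>" by (simp add: \<gamma>_def \<alpha>_def t power_mult[symmetric] mult.commute)
    have "\<alpha> \<noteq> 0" using roots[rule_format, of \<alpha>] alg[OF \<alpha>] \<alpha> by simp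
    then have nz: "\<gamma> \<noteq> 0" "\<beta> \<noteq> 0" using \<gamma>n \<beta>(2) n by (auto simp: power_0_left)
    have E: "subfield (adjoin F \<alpha>) ambient"
      using finite_extension_adjoin[OF F alg[OF \<alpha>]] by (simp add: finite_extension_def)
    have "root_of_unity (\<gamma> / \<beta>)"
      unfolding root_of_unity_def using n \<gamma>n \<beta>(2) \<open>\<alpha> \<noteq> 0\<close>
      by (intro exI[of _ n]) (simp add: power_divide)
    then have "\<gamma> / \<beta> \<in> adjoin F \<alpha>" using mu subset_adjoin(1)[OF F] by blast
    from subfield_ambientD(4)[OF E this \<beta>(1)] have \<gamma>: "\<gamma> \<in> adjoin F \<alpha>" using nz by simp
    have nopow: "x ^ p \<noteq> \<gamma>" if "Factorial_Ring.prime p" "x \<in> adjoin F \<gamma>" for p x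
    proof
      assume "x ^ p = \<gamma>"
      then have "x ^ (p * n) = \<alpha>" using \<gamma>n by (simp add: power_mult)
      moreover have "x \<in> adjoin F \<alpha>"
        using that(2) adjoin_subset[OF E subset_adjoin(1)[OF F] \<gamma>] by blast
      moreover have p: "p \<ge> 2" using that(1) by (rule prime_ge_2_nat)
      ultimately have "p * n \<in> S \<alpha>" using n by (auto simp: S_def)
      then have "p * n \<le> n" unfolding n_def using S[OF \<alpha>] by (intro Max_ge) auto
      moreover have "2 * n \<le> p * n" using p by simp
      ultimately show False using n by linarith
    qed
    have "algebraic_over F \<gamma>"
      by (rule finite_extension_algebraic[OF finite_extension_adjoin[OF F alg[OF \<alpha>]] \<gamma>])
    from minimal_polynomial[OF F this] obtain R where R: "R \<in> polys_over F" "R \<noteq> 0"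
      "poly R \<gamma> = 0" "degree R > 0" "\<And>g. g \<in> polys_over F \<Longrightarrow> poly g \<gamma> = 0 \<Longrightarrow> R dvd g" by metis
    have Rirr: "irreducible_over F R"
      by (rule irreducible_over_if_minimal[OF F R(1,4,3)]) (use R(5) dvd_imp_degree_le in blast)
    have her: "irreducible_over F (subst_power m R)" if "m > 0" for m
      by (rule irreducible_subst_power[OF F mu Rirr R(3) nz(1) nopow that])
    have "poly (subst_power t R) \<delta> = 0" using R(3) by (simp add: \<gamma>_def)
    from irreducible_over_unique[OF F her[OF \<open>t > 0\<close>] irr this \<delta>]
    obtain e where e: "e \<in> F" "e \<noteq> 0" "Q = Polynomial.smult e (subst_power t R)" by metis
    have "irreducible_over F (subst_power m Q)" if "m \<ge> 1" for m
    proof -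
      have "subst_power m Q = Polynomial.smult e (subst_power (t * m) R)"
        unfolding e(3) subst_power_subst_power[symmetric] by (simp add: subst_power_def pcompose_smult)
      moreover have "irreducible_over F (subst_power (t * m) R)"
        using \<open>t > 0\<close> that by (intro her) auto
      ultimately show ?thesis using irreducible_over_smult[OF F e(1,2)] by simp
    qed
    then show ?thesis using Q(1) by (simp add: hereditarily_irreducible_def)
  qed
  then show "poly_has_good_heredity F P"
    unfolding poly_has_good_heredity_def
    by (intro conjI exI[of _ N] bexI[of _ c] exI[of _ Qs] P N c PN[unfolded PN_def]) blast
qed

section \<open>Extending isomorphisms to the algebraic closure\<close>

text \<open>
  If \<open>p\<close> vanishes at \<open>u\<close>, then \<open>f\<close> divides \<open>p\<close> by minimality, and so \<open>f'\<close> divides \<open>q\<close>. Conversely,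
  among the corresponding pairs whose second member vanishes at \<open>v\<close> take \<open>(g, g')\<close> of least degree;
  then \<open>g\<close> divides both \<open>f\<close> and \<open>p\<close>. As \<open>g\<close> is not constant, the cofactor of \<open>g\<close> in \<open>f\<close> has too small
  a degree to vanish at \<open>u\<close>. So \<open>g\<close> vanishes at \<open>u\<close>, and \<open>p\<close> does as well.
\<close>

lemma poly_corr_root_iff:
  assumes G: "field_corr G" and f: "poly_corr G f f'" "f \<noteq> 0" "poly f u = 0" "poly f' v = 0"
    and min: "\<forall>p p'. poly_corr G p p' \<and> p \<noteq> 0 \<and> poly p u = 0 \<longrightarrow> degree f \<le> degree p"
    and pq: "poly_corr G p q"
  shows "poly p u = 0 \<longleftrightarrow> poly q v = 0"
proof
  assume pu: "poly p u = 0"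
  have "p mod f = 0"
  proof (rule ccontr)
    assume nz: "p mod f \<noteq> 0"
    have "poly (p mod f) u = poly (p - p div f * f) u" by (simp add: minus_div_mult_eq_mod)
    then have "poly (p mod f) u = 0" using pu f(3) by simp
    then have "degree f \<le> degree (p mod f)"
      using min[rule_format, of "p mod f" "q mod f'"] poly_corr_divmod[OF G pq f(1,2)] nz by simp
    then show False using degree_mod_less'[OF f(2) nz] by simp
  qed
  then have "q mod f' = 0"
    using poly_corr_divmod[OF G pq f(1,2)] poly_corr_eq_0_iff[OF G, of "p mod f" "q mod f'"] by simp
  then have "f' dvd q" by (simp add: dvd_eq_mod_eq_0)
  then show "poly q v = 0" using f(4) by (auto elim!: dvdE)
next
  assume qv: "poly q v = 0"
  show "poly p u = 0"
  proof (cases "p = 0")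
    case False
    define P where "P g \<longleftrightarrow> g \<noteq> 0 \<and> (\<exists>g'. poly_corr G g g' \<and> poly g' v = 0)" for g
    have "P p" using False pq qv by (auto simp: P_def)
    then obtain g where g: "P g" and gmin: "\<And>h. P h \<Longrightarrow> degree g \<le> degree h"
      using exists_least_iff[THEN iffD1, of "\<lambda>n. \<exists>g. P g \<and> degree g = n"] by (metis not_less)
    then obtain g' where g': "poly_corr G g g'" "poly g' v = 0" and "g \<noteq> 0" by (auto simp: P_def)
    have dvd: "g dvd h" if h: "poly_corr G h h'" "poly h' v = 0" for h h'
    proof (rule ccontr)
      assume "\<not> g dvd h"
      then have nz: "h mod g \<noteq> 0" by (simp add: dvd_eq_mod_eq_0)
      have "poly (h' mod g') v = poly (h' - h' div g' * g') v" by (simp add: minus_div_mult_eq_mod)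
      then have "P (h mod g)"
        using nz h g' poly_corr_divmod[OF G h(1) g'(1) \<open>g \<noteq> 0\<close>] by (auto simp: P_def)
      from gmin[OF this] show False using degree_mod_less'[OF \<open>g \<noteq> 0\<close> nz] by simp
    qed
    have "g dvd f" by (rule dvd[OF f(1,4)])
    then obtain h where h: "f = g * h" by (rule dvdE)
    then have fdg: "f div g = h" "h \<noteq> 0" using f(2) by auto
    have "poly g u = 0"
    proof (rule ccontr)
      assume "poly g u \<noteq> 0"
      then have "poly h u = 0" using f(3) h \<open>poly g u \<noteq> 0\<close> by simp
      then have "degree f \<le> degree h"
        using min[rule_format, of "f div g" "f' div g'"] poly_corr_divmod[OF G f(1) g'(1) \<open>g \<noteq> 0\<close>] fdg by simp
      then have "degree g = 0" using degree_mult_eq[OF \<open>g \<noteq> 0\<close> fdg(2)] h by simp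
      then have "degree g' = 0" "g' \<noteq> 0"
        using poly_corr_degree[OF G g'(1)] poly_corr_eq_0_iff[OF G g'(1)] \<open>g \<noteq> 0\<close> by auto
      then obtain c where "g' = [:c:]" "c \<noteq> 0" by (metis degree_eq_zeroE pCons_0_0)
      then show False using g'(2) by simp
    qed
    moreover have "g dvd p" by (rule dvd[OF pq qv])
    ultimately show ?thesis by (auto elim!: dvdE)
  qed simp
qed

text \<open>
  The extension of an isomorphism to a simple algebraic extension, sending \<open>u\<close> to an arbitrary root \<open>v\<close>
  of the transported minimal polynomial. Quotients of polynomial values are used so that closure under
  inverses is immediate.
\<close>

lemma field_corr_extend:
  assumes G: "field_corr G" and f: "poly_corr G f f'" "f \<noteq> 0" "poly f u = 0" "poly f' v = 0"
    and min: "\<forall>p p'. poly_corr G p p' \<and> p \<noteq> 0 \<and> poly p u = 0 \<longrightarrow> degree f \<le> degree p"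
  obtains G' where "field_corr G'" "G \<subseteq> G'" "(u, v) \<in> G'"
    "\<And>A. subfield A ambient \<Longrightarrow> G \<subseteq> A \<times> A \<Longrightarrow> u \<in> A \<Longrightarrow> v \<in> A \<Longrightarrow> G' \<subseteq> A \<times> A"
proof -
  define G' where "G' = {(poly p u / poly r u, poly q v / poly s v) | p q r s.
    poly_corr G p q \<and> poly_corr G r s \<and> poly r u \<noteq> 0}"
  have G'I: "(poly p u / poly r u, poly q v / poly s v) \<in> G'"
    if "poly_corr G p q" "poly_corr G r s" "poly r u \<noteq> 0" for p q r s
    using that by (auto simp: G'_def)
  have root_iff: "poly p u = 0 \<longleftrightarrow> poly q v = 0" if "poly_corr G p q" for p q
    by (rule poly_corr_root_iff[OF G f min that])
  have one: "poly_corr G 1 1" and zero: "poly_corr G 0 0" by (intro poly_corr_closed[OF G])+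
  have G'I1: "(poly p u, poly q v) \<in> G'" if "poly_corr G p q" for p q
    using G'I[OF that one] by simp
  have "field_corr G'"
    unfolding field_corr_def
  proof (intro conjI ballI, goal_cases)
    case 1
    show ?case using G'I1[OF one] by simp
  next
    case (2 a)
    then obtain p q r s where a: "a = (poly p u / poly r u, poly q v / poly s v)"
      "poly_corr G p q" "poly_corr G r s" "poly r u \<noteq> 0" by (auto simp: G'_def)
    have sv: "poly s v \<noteq> 0" using root_iff[OF a(3)] a(4) by simp
    show ?case
      unfolding a(1) prod.case
    proof (intro ballI, goal_cases)
      case (1 b)
      then obtain p' q' r' s' where b: "b = (poly p' u / poly r' u, poly q' v / poly s' v)"
        "poly_corr G p' q'" "poly_corr G r' s'" "poly r' u \<noteq> 0" by (auto simp: G'_def)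
      have s'v: "poly s' v \<noteq> 0" using root_iff[OF b(3)] b(4) by simp
      have "(poly (p * r' + p' * r) u / poly (r * r') u, poly (q * s' + q' * s) v / poly (s * s') v) \<in> G'"
        using a b by (intro G'I poly_corr_closed[OF G]) auto
      moreover have "(poly (p * p') u / poly (r * r') u, poly (q * q') v / poly (s * s') v) \<in> G'"
        using a b by (intro G'I poly_corr_closed[OF G]) auto
      ultimately show ?case
        unfolding b(1) using a(4) b(4) sv s'v by (simp add: field_simps)
    qed
  next
    case (3 a)
    then obtain p q r s where a: "a = (poly p u / poly r u, poly q v / poly s v)"
      "poly_corr G p q" "poly_corr G r s" "poly r u \<noteq> 0" by (auto simp: G'_def)
    have sv: "poly s v \<noteq> 0" using root_iff[OF a(3)] a(4) by simp
    have "(poly (- p) u / poly r u, poly (- q) v / poly s v) \<in> G'"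
      using a by (intro G'I poly_corr_closed[OF G]) auto
    moreover have "(inverse (poly p u / poly r u), inverse (poly q v / poly s v)) \<in> G'"
    proof (cases "poly p u = 0")
      case True
      then show ?thesis using G'I1[OF zero] root_iff[OF a(2)] by simp
    next
      case False
      then show ?thesis using G'I[OF a(3,2)] by simp
    qed
    ultimately show ?case
      unfolding a(1) using a(4) sv root_iff[OF a(2)] by simp
  qed
  moreover have "G \<subseteq> G'"
  proof clarify
    fix a b assume "(a, b) \<in> G"
    then have "poly_corr G [:a:] [:b:]" by (intro poly_corr_closed[OF G])
    from G'I1[OF this] show "(a, b) \<in> G'" by simp
  qed
  moreover have "(u, v) \<in> G'"
  proof -
    have "poly_corr G [:0, 1:] [:0, 1:]" by (intro poly_corr_closed[OF G] field_corrD[OF G])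
    from G'I1[OF this] show ?thesis by simp
  qed
  moreover have "G' \<subseteq> A \<times> A" if A: "subfield A ambient" "G \<subseteq> A \<times> A" "u \<in> A" "v \<in> A" for A
  proof -
    have "poly p u \<in> A \<and> poly q v \<in> A" if "poly_corr G p q" for p q
    proof -
      have "poly.coeff p i \<in> A \<and> poly.coeff q i \<in> A" for i
        using that[unfolded poly_corr_def, rule_format, of i] A(2) by blast
      then show ?thesis
        by (auto intro!: poly_in_subfield[OF A(1)] A(3,4) simp: polys_over_def)
    qed
    then show ?thesis by (auto simp: G'_def intro!: subfield_ambientD[OF A(1)])
  qed
  ultimately show ?thesis using that by blast
qed

lemma field_corr_least_poly:
  assumes "poly_corr G p p'" "p \<noteq> 0" "poly p u = 0"
  obtains f f' where "poly_corr G f f'" "f \<noteq> 0" "poly f u = 0"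
    "\<forall>p p'. poly_corr G p p' \<and> p \<noteq> 0 \<and> poly p u = 0 \<longrightarrow> degree f \<le> degree p"
proof -
  define P where "P f \<longleftrightarrow> f \<noteq> 0 \<and> poly f u = 0 \<and> (\<exists>f'. poly_corr G f f')" for f
  have "P p" using assms by (auto simp: P_def)
  then obtain f where f: "P f" and min: "\<And>h. P h \<Longrightarrow> degree f \<le> degree h"
    using exists_least_iff[THEN iffD1, of "\<lambda>n. \<exists>g. P g \<and> degree g = n"] by (metis not_less)
  then obtain f' where "poly_corr G f f'" by (auto simp: P_def)
  then show ?thesis using that[of f f'] f min unfolding P_def by blast
qed

text \<open>
  A maximal graph inside \<open>A \<times> A\<close> is defined on all of \<open>A\<close>, since otherwise it could be extended by one
  more algebraic element, for which an image exists because the ambient field is algebraically closed.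
\<close>

lemma field_corr_total:
  fixes k :: "'a :: alg_closed_field set"
  assumes k: "subfield k ambient" and A: "A = {x. algebraic_over k x}"
    and G: "field_corr G" "Id_on k \<subseteq> G" "G \<subseteq> A \<times> A"
  obtains M where "field_corr M" "G \<subseteq> M" "M \<subseteq> A \<times> A" "Domain M = A"
proof -
  have sA: "subfield A ambient" unfolding A by (rule subfield_algebraic_over[OF k])
  define Exts where "Exts = {M. field_corr M \<and> G \<subseteq> M \<and> M \<subseteq> A \<times> A}"
  have "\<exists>M\<in>Exts. \<forall>N\<in>Exts. M \<subseteq> N \<longrightarrow> N = M"
  proof (rule subset_Zorn_nonempty)
    show "Exts \<noteq> {}" using G by (auto simp: Exts_def)
    fix Ch assume Ch: "Ch \<noteq> {}" "subset.chain Exts Ch"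
    have mem: "field_corr M" "G \<subseteq> M" "M \<subseteq> A \<times> A" if "M \<in> Ch" for M
      using that Ch(2) by (auto simp: subset.chain_def Exts_def)
    have common: "\<exists>M\<in>Ch. a \<in> M \<and> b \<in> M" if "a \<in> \<Union>Ch" "b \<in> \<Union>Ch" for a b
    proof -
      from that obtain M N where "M \<in> Ch" "a \<in> M" "N \<in> Ch" "b \<in> N" by auto
      moreover from this have "M \<subseteq> N \<or> N \<subseteq> M" using Ch(2) by (auto simp: subset.chain_def)
      ultimately show ?thesis by auto
    qed
    have "field_corr (\<Union>Ch)"
      unfolding field_corr_def
    proof (intro conjI ballI, goal_cases)
      case 1
      show ?case using Ch(1) mem(1) field_corrD(1) by fast
    next
      case (2 a)
      show ?case
      proof (cases a)
        case (Pair x x')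
        show ?thesis
          unfolding Pair prod.case
        proof (intro ballI, goal_cases)
          case (1 b)
          obtain M where "M \<in> Ch" "a \<in> M" "b \<in> M" using common[OF 2 1] by auto
          then show ?case using field_corrD(3,4)[OF mem(1)] Pair by (cases b) blast
        qed
      qed
    next
      case (3 a)
      then obtain M where M: "M \<in> Ch" "a \<in> M" by auto
      then show ?case using mem(1)[OF M(1)] by (auto simp: field_corr_def)
    qed
    moreover have "G \<subseteq> \<Union>Ch" using Ch(1) mem(2) by blast
    moreover have "\<Union>Ch \<subseteq> A \<times> A" using mem(3) by blast
    ultimately show "\<Union>Ch \<in> Exts" by (simp add: Exts_def)
  qed
  then obtain M where "M \<in> Exts" and max: "\<And>N. N \<in> Exts \<Longrightarrow> M \<subseteq> N \<Longrightarrow> N = M" by auto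
  then have M: "field_corr M" "G \<subseteq> M" "M \<subseteq> A \<times> A" by (auto simp: Exts_def)
  have "u \<in> Domain M" if u: "u \<in> A" for u
  proof -
    from u obtain p where p: "p \<in> polys_over k" "p \<noteq> 0" "poly p u = 0"
      by (auto simp: A algebraic_over_def)
    have "Id_on k \<subseteq> M" using G(2) M(2) by blast
    then have "poly_corr M p p"
      using p(1) unfolding poly_corr_def polys_over_def by blast
    from field_corr_least_poly[OF this p(2,3)] obtain f f' where f: "poly_corr M f f'" "f \<noteq> 0"
      "poly f u = 0" and
      min: "\<forall>p p'. poly_corr M p p' \<and> p \<noteq> 0 \<and> poly p u = 0 \<longrightarrow> degree f \<le> degree p"
      by metis
    have "degree f > 0" using f(2,3) by (auto intro!: Nat.gr0I elim!: degree_eq_zeroE)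
    then have "degree f' > 0" using poly_corr_degree[OF M(1) f(1)] by simp
    then obtain v where v: "poly f' v = 0" using alg_closed_imp_poly_has_root by blast
    have "f' \<noteq> 0" using poly_corr_eq_0_iff[OF M(1) f(1)] f(2) by simp
    moreover have "poly.coeff f' i \<in> A" for i
      using f(1)[unfolded poly_corr_def, rule_format, of i] M(3) by blast
    then have "f' \<in> polys_over A" by (simp add: polys_over_def)
    ultimately have "algebraic_over A v" using v by (auto simp: algebraic_over_def)
    then have "v \<in> A" using algebraic_over_trans[OF k sA] by (simp add: A)
    obtain M' where M': "field_corr M'" "M \<subseteq> M'" "(u, v) \<in> M'"
      "\<And>A. subfield A ambient \<Longrightarrow> M \<subseteq> A \<times> A \<Longrightarrow> u \<in> A \<Longrightarrow> v \<in> A \<Longrightarrow> M' \<subseteq> A \<times> A"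
      using field_corr_extend[OF M(1) f v min] by metis
    have "M' \<in> Exts"
      using M'(1,2) M(2) M'(4)[OF sA M(3) u \<open>v \<in> A\<close>] unfolding Exts_def by blast
    then show ?thesis using max M'(2,3) by blast
  qed
  then show ?thesis using that M by blast
qed

text \<open>
  Endomorphisms over \<open>k\<close> of the algebraic closure of \<open>k\<close> in the ambient field; they are in fact
  automorphisms, and play the role of the absolute Galois group. Values at elements that are
  transcendental over \<open>k\<close> are arbitrary.
\<close>

definition alg_endo :: "'a :: field set \<Rightarrow> ('a \<Rightarrow> 'a) \<Rightarrow> bool" where
  "alg_endo k \<sigma> \<longleftrightarrow> (\<forall>c\<in>k. \<sigma> c = c) \<and> (\<forall>x. algebraic_over k x \<longrightarrow> algebraic_over k (\<sigma> x)) \<and>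
     (\<forall>x y. algebraic_over k x \<longrightarrow> algebraic_over k y \<longrightarrow>
        \<sigma> (x + y) = \<sigma> x + \<sigma> y \<and> \<sigma> (x * y) = \<sigma> x * \<sigma> y)"

lemma alg_endo_of_field_corr:
  assumes A: "A = {x. algebraic_over k x}"
    and M: "field_corr M" "Id_on k \<subseteq> M" "M \<subseteq> A \<times> A" "Domain M = A"
  obtains \<sigma> where "alg_endo k \<sigma>" "\<And>x y. (x, y) \<in> M \<Longrightarrow> \<sigma> x = y"
proof -
  define \<sigma> where "\<sigma> x = (THE y. (x, y) \<in> M)" for x
  have \<sigma>: "\<sigma> x = y" if "(x, y) \<in> M" for x y
    unfolding \<sigma>_def using that field_corrD(9)[OF M(1) that] by (intro the_equality) blast+
  have mem: "(x, \<sigma> x) \<in> M" if "algebraic_over k x" for x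
    using that M(4) \<sigma> unfolding A by blast
  have "alg_endo k \<sigma>"
    unfolding alg_endo_def
  proof (intro conjI ballI allI impI)
    fix c assume "c \<in> k"
    then show "\<sigma> c = c" using M(2) by (intro \<sigma>) auto
  next
    fix x assume "algebraic_over k x"
    from mem[OF this] show "algebraic_over k (\<sigma> x)" using M(3) by (auto simp: A)
  next
    fix x y assume "algebraic_over k x" "algebraic_over k y"
    then show "\<sigma> (x + y) = \<sigma> x + \<sigma> y" "\<sigma> (x * y) = \<sigma> x * \<sigma> y"
      by (auto intro!: \<sigma> field_corrD[OF M(1)] mem)
  qed
  then show ?thesis using that \<sigma> by blast
qed

text \<open>
  In characteristic zero the minimal polynomial of \<open>x\<close> has a second root \<open>v\<close>, for otherwise \<open>x\<close> would
  also be a root of its derivative. The isomorphism \<open>k(x) \<cong> k(v)\<close> extends to the algebraic closure.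
\<close>

lemma alg_endo_moves:
  fixes k :: "'a :: {alg_closed_field, field_char_0} set"
  assumes k: "subfield k ambient" and x: "algebraic_over k x" "x \<notin> k"
  obtains \<sigma> where "alg_endo k \<sigma>" "\<sigma> x \<noteq> x"
proof -
  define A where "A = {x. algebraic_over k x}"
  have sA: "subfield A ambient" unfolding A_def by (rule subfield_algebraic_over[OF k])
  have kA: "k \<subseteq> A"
    using finite_extension_algebraic[OF finite_extension_refl[OF k]] by (auto simp: A_def)
  from minimal_polynomial[OF k x(1)] obtain f where f: "f \<in> polys_over k" "f \<noteq> 0"
    "poly f x = 0" "degree f > 0" and dvd: "\<And>g. g \<in> polys_over k \<Longrightarrow> poly g x = 0 \<Longrightarrow> f dvd g"
    by metis
  obtain g where g: "f = [:- x, 1:] * g" using f(3) by (auto simp: poly_eq_0_iff_dvd elim: dvdE)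
  have g0: "g \<noteq> 0" using g f(2) by auto
  obtain v where v: "poly f v = 0" "v \<noteq> x"
  proof (cases "degree g = 0")
    case True
    then obtain c where c: "g = [:c:]" by (auto elim: degree_eq_zeroE)
    then have c0: "c \<noteq> 0" using g0 by simp
    have "poly.coeff f 0 = - x * c" "poly.coeff f 1 = c" unfolding g c by simp_all
    then have "x = - (poly.coeff f 0 / poly.coeff f 1)" using c0 by simp
    also have "\<dots> \<in> k" using coeff_polys_over[OF f(1)] by (intro subfield_ambientD[OF k])
    finally show ?thesis using x(2) by blast
  next
    case False
    then obtain w where w: "poly g w = 0" using alg_closed_imp_poly_has_root by blast
    have "w \<noteq> x"
    proof
      assume "w = x"
      then obtain h where h: "g = [:- x, 1:] * h" using w by (auto simp: poly_eq_0_iff_dvd elim: dvdE)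
      have "poly (pderiv f) x = 0" unfolding g h by (simp add: pderiv_mult del: mult_pCons_left)
      moreover have "poly.coeff (pderiv f) i \<in> k" for i
        unfolding coeff_pderiv by (intro subfield_ambientD(4,10)[OF k] coeff_polys_over[OF f(1)])
      then have "pderiv f \<in> polys_over k" by (simp add: polys_over_def)
      ultimately have "f dvd pderiv f" using dvd[of "pderiv f"] by simp
      moreover have "pderiv f \<noteq> 0" using f(4) by (simp add: pderiv_eq_0_iff)
      ultimately have "degree f \<le> degree (pderiv f)" by (rule dvd_imp_degree_le)
      then show False using f(4) by (simp add: degree_pderiv)
    qed
    moreover have "poly f w = 0" using g w by simp
    ultimately show ?thesis using that by blast
  qed
  note G = field_corr_Id_on[OF k]
  have "\<forall>p p'. poly_corr (Id_on k) p p' \<and> p \<noteq> 0 \<and> poly p x = 0 \<longrightarrow> degree f \<le> degree p"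
    by (auto simp: poly_corr_Id_on intro!: dvd_imp_degree_le dvd)
  from field_corr_extend[OF G f(1)[unfolded polys_over_iff_poly_corr] f(2,3) v(1) this]
  obtain G' where G': "field_corr G'" "Id_on k \<subseteq> G'" "(x, v) \<in> G'"
    "\<And>A. subfield A ambient \<Longrightarrow> Id_on k \<subseteq> A \<times> A \<Longrightarrow> x \<in> A \<Longrightarrow> v \<in> A \<Longrightarrow> G' \<subseteq> A \<times> A"
    by metis
  have "v \<in> A" "x \<in> A" using f v x by (auto simp: A_def algebraic_over_def)
  then have "G' \<subseteq> A \<times> A" using kA by (intro G'(4)[OF sA]) auto
  from field_corr_total[OF k A_def G'(1,2) this] obtain M where M: "field_corr M" "G' \<subseteq> M"
    "M \<subseteq> A \<times> A" "Domain M = A" by metis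
  have "Id_on k \<subseteq> M" using G'(2) M(2) by blast
  from alg_endo_of_field_corr[OF A_def M(1) this M(3,4)] obtain \<sigma>
    where \<sigma>: "alg_endo k \<sigma>" "\<And>x y. (x, y) \<in> M \<Longrightarrow> \<sigma> x = y" by metis
  have "\<sigma> x = v" using G'(3) M(2) by (intro \<sigma>(2)) blast
  then show ?thesis using that \<sigma>(1) v(2) by blast
qed

section \<open>Automorphisms and the maximal abelian extension\<close>

text \<open>
  Additive and multiplicative maps preserve the remaining field operations and are injective, so that
  results on graphs apply to homomorphisms given as functions.
\<close>

lemma field_corr_graph:
  assumes L: "subfield L ambient" and "\<sigma> 1 = 1"
    and add: "\<And>x y. x \<in> L \<Longrightarrow> y \<in> L \<Longrightarrow> \<sigma> (x + y) = \<sigma> x + \<sigma> y"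
    and mult: "\<And>x y. x \<in> L \<Longrightarrow> y \<in> L \<Longrightarrow> \<sigma> (x * y) = \<sigma> x * \<sigma> y"
  shows "field_corr {(x, \<sigma> x) |x. x \<in> L}"
proof -
  note L' = subfield_ambientD[OF L]
  have "\<sigma> (0 + 0) = \<sigma> 0 + \<sigma> 0" by (rule add[OF L'(1) L'(1)])
  then have zero: "\<sigma> 0 = 0" by (metis add_0_right add_left_cancel)
  have minus: "\<sigma> (- x) = - \<sigma> x" if "x \<in> L" for x
    using add[of x "- x"] that L'(5) zero by (simp add: eq_neg_iff_add_eq_0 add.commute)
  have inv: "\<sigma> x * \<sigma> (inverse x) = 1" if "x \<in> L" "x \<noteq> 0" for x
    using mult[of x "inverse x"] that L'(7) assms(2) by simp
  have zero_iff: "\<sigma> x = 0 \<longleftrightarrow> x = 0" if "x \<in> L" for x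
    using inv[of x] that zero by (cases "x = 0") auto
  have inverse: "\<sigma> (inverse x) = inverse (\<sigma> x)" if "x \<in> L" for x
  proof (cases "x = 0")
    case False
    show ?thesis by (rule inverse_unique[symmetric]) (rule inv[OF that False])
  qed (simp add: zero)
  show ?thesis
    unfolding field_corr_def
    using L' assms(2) add mult minus inverse zero_iff by auto
qed

lemma alg_endo_graph:
  assumes k: "subfield k ambient" and \<sigma>: "alg_endo k \<sigma>"
  shows "field_corr {(x, \<sigma> x) |x. algebraic_over k x}"
  using field_corr_graph[OF subfield_algebraic_over[OF k], of \<sigma>] \<sigma> subfield_ambientD(2)[OF k]
  by (simp add: alg_endo_def)

lemma algebraic_over_base: "subfield k ambient \<Longrightarrow> x \<in> k \<Longrightarrow> algebraic_over k x"
  using finite_extension_algebraic finite_extension_refl by blast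

lemma alg_endoD:
  assumes k: "subfield k ambient" and \<sigma>: "alg_endo k \<sigma>"
  shows "c \<in> k \<Longrightarrow> \<sigma> c = c" "algebraic_over k x \<Longrightarrow> algebraic_over k (\<sigma> x)"
    "algebraic_over k x \<Longrightarrow> algebraic_over k y \<Longrightarrow> \<sigma> (x + y) = \<sigma> x + \<sigma> y"
    "algebraic_over k x \<Longrightarrow> algebraic_over k y \<Longrightarrow> \<sigma> (x * y) = \<sigma> x * \<sigma> y"
    "algebraic_over k x \<Longrightarrow> algebraic_over k y \<Longrightarrow> \<sigma> (x / y) = \<sigma> x / \<sigma> y"
    "algebraic_over k x \<Longrightarrow> algebraic_over k y \<Longrightarrow> \<sigma> x = \<sigma> y \<longleftrightarrow> x = y"
    "algebraic_over k x \<Longrightarrow> \<sigma> (- x) = - \<sigma> x"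
    "algebraic_over k x \<Longrightarrow> \<sigma> (inverse x) = inverse (\<sigma> x)"
    "algebraic_over k x \<Longrightarrow> \<sigma> (x ^ n) = \<sigma> x ^ n"
    "algebraic_over k x \<Longrightarrow> p \<in> polys_over k \<Longrightarrow> \<sigma> (poly p x) = poly p (\<sigma> x)"
proof -
  note G = alg_endo_graph[OF k \<sigma>]
  show base: "\<And>c. c \<in> k \<Longrightarrow> \<sigma> c = c" using \<sigma> by (simp add: alg_endo_def)
  show "algebraic_over k x \<Longrightarrow> algebraic_over k (\<sigma> x)"
    "algebraic_over k x \<Longrightarrow> algebraic_over k y \<Longrightarrow> \<sigma> (x + y) = \<sigma> x + \<sigma> y"
    and mult: "\<And>x y. algebraic_over k x \<Longrightarrow> algebraic_over k y \<Longrightarrow> \<sigma> (x * y) = \<sigma> x * \<sigma> y"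
    using \<sigma> by (auto simp: alg_endo_def)
  show div: "\<And>x y. algebraic_over k x \<Longrightarrow> algebraic_over k y \<Longrightarrow> \<sigma> (x / y) = \<sigma> x / \<sigma> y"
    using field_corrD(7)[OF G] by auto
  show "algebraic_over k x \<Longrightarrow> algebraic_over k y \<Longrightarrow> \<sigma> x = \<sigma> y \<longleftrightarrow> x = y"
    using field_corrD(9)[OF G, of x "\<sigma> x" y "\<sigma> y"] by auto
  show "algebraic_over k x \<Longrightarrow> \<sigma> (- x) = - \<sigma> x"
    using field_corrD(5)[OF G, of x "\<sigma> x"] by auto
  have one: "algebraic_over k 1" "\<sigma> 1 = 1"
    using algebraic_over_base[OF k] base subfield_ambientD(2)[OF k] by auto
  show "algebraic_over k x \<Longrightarrow> \<sigma> (inverse x) = inverse (\<sigma> x)"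
    using div[OF one(1), of x] one(2) by (simp add: inverse_eq_divide)
  show "algebraic_over k x \<Longrightarrow> \<sigma> (x ^ n) = \<sigma> x ^ n"
  proof (induction n)
    case (Suc n)
    have "algebraic_over k (x ^ n)"
      using subfield_ambientD(9)[OF subfield_algebraic_over[OF k]] Suc.prems by simp
    then show ?case using mult Suc by simp
  qed (simp add: one)
  show "\<sigma> (poly p x) = poly p (\<sigma> x)" if "algebraic_over k x" "p \<in> polys_over k"
  proof -
    have "poly_corr {(x, \<sigma> x) |x. algebraic_over k x} p p"
      unfolding poly_corr_def using coeff_polys_over[OF that(2)] algebraic_over_base[OF k] base by auto
    then show ?thesis using poly_corr_poly[OF G _, of p p x "\<sigma> x"] that(1) by auto
  qed
qed

text \<open>
  Surjectivity comes for free: an endomorphism permutes the finitely many roots in \<open>L\<close> of each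
  nonzero polynomial over \<open>k\<close>.
\<close>

lemma alg_endo_image:
  assumes k: "subfield k ambient" and \<sigma>: "alg_endo k \<sigma>"
    and L: "\<And>x. x \<in> L \<Longrightarrow> algebraic_over k x" "\<And>x. x \<in> L \<Longrightarrow> \<sigma> x \<in> L"
  shows "bij_betw \<sigma> L L"
proof -
  have inj: "inj_on \<sigma> L"
    using L(1) alg_endoD(6)[OF k \<sigma>] by (intro inj_onI) blast
  moreover have "x \<in> \<sigma> ` L" if x: "x \<in> L" for x
  proof -
    obtain p where p: "p \<in> polys_over k" "p \<noteq> 0" "poly p x = 0"
      using L(1)[OF x] by (auto simp: algebraic_over_def)
    define S where "S = {r \<in> L. poly p r = 0}"
    have "finite S" unfolding S_def using poly_roots_finite[OF p(2)] by simp
    moreover have "\<sigma> ` S \<subseteq> S"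
    proof clarify
      fix r assume r: "r \<in> S"
      then have "poly p (\<sigma> r) = \<sigma> (poly p r)"
        using L(1) by (intro alg_endoD(10)[OF k \<sigma> _ p(1), symmetric]) (simp add: S_def)
      also have "\<dots> = 0" using r alg_endoD(1)[OF k \<sigma>] subfield_ambientD(1)[OF k] by (simp add: S_def)
      finally show "\<sigma> r \<in> S" using r L(2) by (simp add: S_def)
    qed
    moreover have "inj_on \<sigma> S" using inj by (rule inj_on_subset) (auto simp: S_def)
    ultimately have "\<sigma> ` S = S" by (rule endo_inj_surj)
    moreover have "x \<in> S" using x p(3) by (simp add: S_def)
    ultimately show ?thesis by (auto simp: S_def)
  qed
  ultimately show ?thesis using L(2) by (auto simp: bij_betw_def)
qed

lemma alg_endo_comp:
  assumes "alg_endo k \<sigma>" "alg_endo k \<tau>"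
  shows "alg_endo k (\<lambda>x. \<sigma> (\<tau> x))"
  using assms by (simp add: alg_endo_def)

text \<open>
  Lets agreement of two endomorphisms be checked on generators of a field.
\<close>

lemma subfield_equalizer:
  assumes k: "subfield k ambient" and \<sigma>: "alg_endo k \<sigma>" and \<tau>: "alg_endo k \<tau>"
  shows "subfield {x. algebraic_over k x \<and> \<sigma> x = \<tau> x} ambient"
  using subfield_ambientD(2-7)[OF subfield_algebraic_over[OF k]] subfield_ambientD(2)[OF k]
    alg_endoD[OF k \<sigma>] alg_endoD[OF k \<tau>]
  by (intro subfield_ambientI) simp_all

text \<open>
  Enlarging the base field by algebraic elements does not change the algebraic closure.
\<close>

lemma alg_endo_mono:
  assumes k: "subfield k ambient" "subfield k' ambient" "k \<subseteq> k'" "\<And>x. x \<in> k' \<Longrightarrow> algebraic_over k x"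
    and "alg_endo k' \<sigma>"
  shows "alg_endo k \<sigma>"
proof -
  have "algebraic_over k' x \<longleftrightarrow> algebraic_over k x" for x
    using algebraic_over_trans[OF k(1,2,4)] algebraic_over_mono[OF k(3)] by blast
  then show ?thesis using assms(3,5) by (auto simp: alg_endo_def)
qed

lemma automorphisms_over_iff:
  assumes L: "subfield L ambient"
  shows "\<sigma> \<in> automorphisms_over k L \<longleftrightarrow> bij_betw \<sigma> L L \<and> \<sigma> 1 = 1 \<and> (\<forall>c\<in>k. \<sigma> c = c) \<and>
    (\<forall>x\<in>L. \<forall>y\<in>L. \<sigma> (x + y) = \<sigma> x + \<sigma> y \<and> \<sigma> (x * y) = \<sigma> x * \<sigma> y)"
  by (auto simp: automorphisms_over_def ring_iso_def ring_hom_def bij_betw_apply)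

lemma automorphism_graph:
  assumes L: "subfield L ambient" and \<sigma>: "\<sigma> \<in> automorphisms_over k L"
  shows "field_corr {(x, \<sigma> x) |x. x \<in> L}"
  using \<sigma> automorphisms_over_iff[OF L] by (intro field_corr_graph[OF L]) auto

lemma automorphism_poly:
  assumes k: "k \<subseteq> L" and L: "subfield L ambient" and \<sigma>: "\<sigma> \<in> automorphisms_over k L"
    and "p \<in> polys_over k" "x \<in> L"
  shows "\<sigma> (poly p x) = poly p (\<sigma> x)"
proof -
  have "poly_corr {(x, \<sigma> x) |x. x \<in> L} p p"
    using coeff_polys_over[OF assms(4)] k \<sigma> unfolding poly_corr_def automorphisms_over_iff[OF L] by auto
  then show ?thesis
    using poly_corr_poly[OF automorphism_graph[OF L \<sigma>], of p p x "\<sigma> x"] assms(5) by auto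
qed

lemma alg_endo_restrict:
  assumes k: "subfield k ambient" and \<sigma>: "alg_endo k \<sigma>" and L: "subfield L ambient"
    "\<And>x. x \<in> L \<Longrightarrow> algebraic_over k x" "\<And>x. x \<in> L \<Longrightarrow> \<sigma> x \<in> L"
  shows "\<sigma> \<in> automorphisms_over k L"
  unfolding automorphisms_over_iff[OF L(1)]
  using alg_endo_image[OF k \<sigma> L(2,3)] alg_endoD(1,3,4)[OF k \<sigma>] L(2) subfield_ambientD(2)[OF k]
  by simp

text \<open>
  The orbit of \<open>x\<close> under the automorphisms of \<open>L\<close> is finite, and the monic polynomial having the
  orbit as its roots has invariant coefficients, that is, coefficients in \<open>k\<close>. Any conjugation of the
  algebraic closure maps \<open>x\<close> to another root of this polynomial, hence into the orbit.
\<close>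

lemma galois_extension_stable:
  assumes gal: "galois_extension k L" and \<sigma>: "alg_endo k \<sigma>" and x: "x \<in> L"
  shows "\<sigma> x \<in> L"
proof -
  have k: "subfield k ambient" and L: "subfield L ambient" and kL: "k \<subseteq> L"
    and alg: "\<And>x. x \<in> L \<Longrightarrow> algebraic_over k x"
    and fixed: "\<And>c. c \<in> L \<Longrightarrow> (\<forall>\<tau>\<in>automorphisms_over k L. \<tau> c = c) \<Longrightarrow> c \<in> k"
    using gal by (auto simp: galois_extension_def)
  note aut = automorphisms_over_iff[OF L]
  define Orb where "Orb = (\<lambda>\<tau>. \<tau> x) ` automorphisms_over k L"
  have OL: "Orb \<subseteq> L" using x by (auto simp: Orb_def aut bij_betw_apply)
  obtain p where p: "p \<in> polys_over k" "p \<noteq> 0" "poly p x = 0"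
    using alg[OF x] by (auto simp: algebraic_over_def)
  have "poly p y = 0" if y: "y \<in> Orb" for y
  proof -
    obtain \<tau> where \<tau>: "\<tau> \<in> automorphisms_over k L" "y = \<tau> x" using y unfolding Orb_def by blast
    have "poly p y = \<tau> (poly p x)" using automorphism_poly[OF kL L \<tau>(1) p(1) x] \<tau>(2) by simp
    also have "\<dots> = 0" using p(3) \<tau>(1) subfield_ambientD(1)[OF k] by (simp add: aut)
    finally show ?thesis .
  qed
  then have fin: "finite Orb" using poly_roots_finite[OF p(2)] by (elim finite_subset[rotated]) blast
  have image: "bij_betw \<tau> Orb Orb" if \<tau>: "\<tau> \<in> automorphisms_over k L" for \<tau>
  proof -
    have "\<tau> \<circ> \<rho> \<in> automorphisms_over k L" if \<rho>: "\<rho> \<in> automorphisms_over k L" for \<rho>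
      using \<tau> \<rho> unfolding aut by (auto intro: bij_betw_trans simp: bij_betw_apply)
    then have "(\<tau> \<circ> \<rho>) x \<in> Orb" if "\<rho> \<in> automorphisms_over k L" for \<rho>
      unfolding Orb_def using that by (intro imageI)
    then have "\<tau> ` Orb \<subseteq> Orb" by (auto simp: Orb_def)
    moreover have "inj_on \<tau> Orb"
      using \<tau> OL by (auto simp: aut bij_betw_def intro: inj_on_subset)
    ultimately show ?thesis using endo_inj_surj[OF fin] by (simp add: bij_betw_def)
  qed
  define f where "f = (\<Prod>r\<in>Orb. [:- r, 1:])"
  have corr: "poly_corr {(x, \<tau> x) |x. x \<in> L} f f" if \<tau>: "\<tau> \<in> automorphisms_over k L" for \<tau>
  proof -
    note G = automorphism_graph[OF L \<tau>]
    have prods: "poly_corr {(x, \<tau> x) |x. x \<in> L} (\<Prod>r\<in>S. [:- r, 1:]) (\<Prod>r\<in>S. [:- \<tau> r, 1:])"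
      if "finite S" "S \<subseteq> L" for S
      using that
    proof (induction S rule: finite_induct)
      case empty
      show ?case by (simp add: poly_corr_closed(2)[OF G])
    next
      case (insert r S)
      have "(r, \<tau> r) \<in> {(x, \<tau> x) |x. x \<in> L}" using insert.prems by auto
      then have "poly_corr {(x, \<tau> x) |x. x \<in> L} [:- r, 1:] [:- \<tau> r, 1:]"
        by (intro poly_corr_closed[OF G] field_corrD[OF G])
      then show ?case
        using insert poly_corr_closed(6)[OF G] by (simp del: mult_pCons_left)
    qed
    have "(\<Prod>r\<in>Orb. [:- \<tau> r, 1:]) = f"
      unfolding f_def by (rule prod.reindex_bij_betw[OF image[OF \<tau>]])
    then show ?thesis using prods[OF fin OL] unfolding f_def by metis
  qed
  have id: "id \<in> automorphisms_over k L" by (auto simp: aut)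
  have "f \<in> polys_over k"
    unfolding polys_over_def
  proof (intro CollectI allI fixed ballI)
    fix i
    show "poly.coeff f i \<in> L" using corr[OF id] by (auto simp: poly_corr_def)
    fix \<tau> assume "\<tau> \<in> automorphisms_over k L"
    from corr[OF this] show "\<tau> (poly.coeff f i) = poly.coeff f i" by (auto simp: poly_corr_def)
  qed
  moreover have "id x \<in> Orb" unfolding Orb_def using id by (rule imageI)
  then have "x \<in> Orb" by simp
  then have "poly f x = 0" using fin by (auto simp: f_def poly_prod)
  ultimately have "poly f (\<sigma> x) = 0"
    using alg_endoD(10)[OF k \<sigma> alg[OF x], of f] alg_endoD(1)[OF k \<sigma>] subfield_ambientD(1)[OF k]
    by simp
  then have "\<sigma> x \<in> Orb" using fin by (auto simp: f_def poly_prod)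
  then show ?thesis using OL by blast
qed

lemma subfield_maximal_abelian_extension: "subfield (maximal_abelian_extension k) ambient"
proof -
  interpret field "ambient :: 'a ring" by (rule field_from_type_algebra)
  show ?thesis unfolding maximal_abelian_extension_def by (rule generate_field_is_subfield) simp
qed

lemma maximal_abelian_extension_least:
  assumes "subfield M ambient" "\<And>L. abelian_extension k L \<Longrightarrow> L \<subseteq> M"
  shows "maximal_abelian_extension k \<subseteq> M"
proof -
  interpret field "ambient :: 'a ring" by (rule field_from_type_algebra)
  show ?thesis
    unfolding maximal_abelian_extension_def
    by (rule generate_field_min_subfield1) (use assms in auto)
qed

lemma abelian_extension_subset:
  "abelian_extension k L \<Longrightarrow> L \<subseteq> maximal_abelian_extension k"
  unfolding maximal_abelian_extension_def by (auto intro: generate_field.incl)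

text \<open>
  The equalizer of the two composites is a subfield, and it contains every abelian extension \<open>L\<close>
  because both maps restrict to automorphisms of \<open>L\<close>.
\<close>

lemma alg_endo_commute_abelian:
  assumes k: "subfield k ambient" and \<sigma>: "alg_endo k \<sigma>" and \<tau>: "alg_endo k \<tau>"
  shows "maximal_abelian_extension k \<subseteq> {x. algebraic_over k x \<and> \<sigma> (\<tau> x) = \<tau> (\<sigma> x)}"
proof (rule maximal_abelian_extension_least)
  show "subfield {x. algebraic_over k x \<and> \<sigma> (\<tau> x) = \<tau> (\<sigma> x)} ambient"
    by (rule subfield_equalizer[OF k alg_endo_comp[OF \<sigma> \<tau>] alg_endo_comp[OF \<tau> \<sigma>]])
  fix L assume L: "abelian_extension k L"
  then have gal: "galois_extension k L" and
    comm: "\<And>\<sigma> \<tau> x. \<sigma> \<in> automorphisms_over k L \<Longrightarrow> \<tau> \<in> automorphisms_over k L \<Longrightarrow> x \<in> L \<Longrightarrow>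
      \<sigma> (\<tau> x) = \<tau> (\<sigma> x)"
    by (auto simp: abelian_extension_def)
  have L': "subfield L ambient" and alg: "\<And>x. x \<in> L \<Longrightarrow> algebraic_over k x"
    using gal by (auto simp: galois_extension_def)
  have "\<rho> \<in> automorphisms_over k L" if "alg_endo k \<rho>" for \<rho>
    using galois_extension_stable[OF gal that] by (intro alg_endo_restrict[OF k that L' alg])
  then show "L \<subseteq> {x. algebraic_over k x \<and> \<sigma> (\<tau> x) = \<tau> (\<sigma> x)}"
    using comm alg \<sigma> \<tau> by blast
qed

section \<open>Cyclotomic extensions\<close>

text \<open>
  The \<open>n\<close> powers of \<open>\<zeta>\<close> are distinct and already exhaust the at most \<open>n\<close> roots of \<open>x^n - 1\<close>.
\<close>

lemma roots_of_unity_powers: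
  fixes \<zeta> :: "'a :: field"
  assumes n: "n > 0" "\<zeta> ^ n = 1" "\<And>i. 0 < i \<Longrightarrow> i < n \<Longrightarrow> \<zeta> ^ i \<noteq> 1" and x: "x ^ n = 1"
  shows "\<exists>i. x = \<zeta> ^ i"
proof -
  define p where "p = Polynomial.monom 1 n - (1 :: 'a poly)"
  have "poly.coeff p n = 1" using n(1) by (simp add: p_def)
  then have p: "p \<noteq> 0" by auto
  have "degree p \<le> n" unfolding p_def by (intro degree_diff_le) (auto simp: degree_monom_le)
  then have card: "card {x. poly p x = 0} \<le> n" using card_poly_roots_bound[OF p] by simp
  have roots: "{x. poly p x = 0} = {x. x ^ n = 1}" by (simp add: p_def poly_monom)
  have \<zeta>0: "\<zeta> \<noteq> 0" using n(1,2) by (auto simp: power_0_left)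
  have "inj_on (\<lambda>i. \<zeta> ^ i) {..<n}"
  proof (rule linorder_inj_onI)
    fix i j assume ij: "i < j" "i \<in> {..<n}" "j \<in> {..<n}"
    show "\<zeta> ^ i \<noteq> \<zeta> ^ j"
    proof
      assume "\<zeta> ^ i = \<zeta> ^ j"
      moreover have "\<zeta> ^ j = \<zeta> ^ i * \<zeta> ^ (j - i)" using ij by (simp add: power_add[symmetric])
      ultimately have "\<zeta> ^ (j - i) = 1" using \<zeta>0 by simp
      then show False using n(3)[of "j - i"] ij by (auto simp: less_imp_diff_less)
    qed
  qed auto
  then have "card ((\<lambda>i. \<zeta> ^ i) ` {..<n}) = n" by (simp add: card_image)
  moreover have "(\<lambda>i. \<zeta> ^ i) ` {..<n} \<subseteq> {x. x ^ n = 1}"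
    using n(2) by (auto simp: power_mult[symmetric] mult.commute[of _ n]) (simp add: power_mult)
  moreover have "finite {x :: 'a. x ^ n = 1}" using poly_roots_finite[OF p] roots by simp
  ultimately have "(\<lambda>i. \<zeta> ^ i) ` {..<n} = {x. x ^ n = 1}"
    using card roots by (intro card_seteq) auto
  then show ?thesis using x by auto
qed

text \<open>
  Automorphisms of \<open>k(\<zeta>)\<close> map \<open>\<zeta>\<close> to powers of itself, and such maps commute. Conjugations of the
  algebraic closure do the same and therefore restrict to \<open>k(\<zeta>)\<close>, which yields enough automorphisms
  to have \<open>k\<close> as the fixed field.
\<close>

lemma abelian_extension_root_of_unity:
  fixes k :: "'a :: {alg_closed_field, field_char_0} set"
  assumes k: "subfield k ambient" and \<zeta>: "root_of_unity \<zeta>"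
  shows "abelian_extension k (adjoin k \<zeta>)"
proof -
  define n where "n = (LEAST n. n \<ge> 1 \<and> \<zeta> ^ n = 1)"
  have n: "n \<ge> 1" "\<zeta> ^ n = 1"
    using LeastI_ex[of "\<lambda>n. n \<ge> 1 \<and> \<zeta> ^ n = 1"] \<zeta> by (auto simp: root_of_unity_def n_def)
  have min: "\<zeta> ^ i \<noteq> 1" if "0 < i" "i < n" for i
    using not_less_Least[of i "\<lambda>n. n \<ge> 1 \<and> \<zeta> ^ n = 1"] that by (auto simp: n_def)
  have pow: "\<exists>i. x = \<zeta> ^ i" if "x ^ n = 1" for x
    using roots_of_unity_powers[OF _ n(2) min that] n(1) by simp
  have "poly (Polynomial.monom 1 n - 1) \<zeta> = 0" "Polynomial.monom 1 n - (1 :: 'a poly) \<noteq> 0"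
    using n by (auto simp: poly_monom monom_eq_1_iff)
  moreover have "Polynomial.monom 1 n - 1 \<in> polys_over k"
    by (intro polys_over_closed[OF k] subfield_ambientD[OF k])
  ultimately have alg\<zeta>: "algebraic_over k \<zeta>" unfolding algebraic_over_def by blast
  define L where "L = adjoin k \<zeta>"
  have ext: "finite_extension k L" unfolding L_def by (rule finite_extension_adjoin[OF k alg\<zeta>])
  then have L: "subfield L ambient" "k \<subseteq> L" by (auto simp: finite_extension_def)
  have \<zeta>L: "\<zeta> \<in> L" unfolding L_def by (rule subset_adjoin(2)[OF k])
  note alg = finite_extension_algebraic[OF ext]
  have fixed: "x \<in> k" if x: "x \<in> L" "\<forall>\<sigma>\<in>automorphisms_over k L. \<sigma> x = x" for x
  proof (rule ccontr)
    assume "x \<notin> k"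
    with alg_endo_moves[OF k alg[OF x(1)]] obtain \<sigma> where \<sigma>: "alg_endo k \<sigma>" "\<sigma> x \<noteq> x" by metis
    have "\<sigma> \<zeta> ^ n = \<sigma> (\<zeta> ^ n)" by (rule alg_endoD(9)[OF k \<sigma>(1) alg\<zeta>, symmetric])
    also have "\<dots> = 1" using n(2) alg_endoD(1)[OF k \<sigma>(1)] subfield_ambientD(2)[OF k] by simp
    finally obtain i where "\<sigma> \<zeta> = \<zeta> ^ i" using pow by blast
    then have "\<sigma> \<zeta> \<in> L" using subfield_ambientD(9)[OF L(1) \<zeta>L] by simp
    then have "poly p (\<sigma> \<zeta>) \<in> L" if "p \<in> polys_over k" for p
      using poly_in_subfield[OF L(1)] polys_over_mono[OF L(2)] that by blast
    then have "\<sigma> y \<in> L" if "y \<in> L" for y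
      using that alg_endoD(10)[OF k \<sigma>(1) alg\<zeta>] unfolding L_def adjoin_def by auto
    then have "\<sigma> \<in> automorphisms_over k L" by (intro alg_endo_restrict[OF k \<sigma>(1) L(1) alg])
    then show False using x(2) \<sigma>(2) by blast
  qed
  have "galois_extension k L"
    unfolding galois_extension_def
  proof (intro conjI ballI k L alg)
    show "{x \<in> L. \<forall>\<sigma>\<in>automorphisms_over k L. \<sigma> x = x} = k"
      using fixed L by (auto simp: automorphisms_over_iff)
  qed
  moreover have "\<sigma> (\<tau> x) = \<tau> (\<sigma> x)"
    if \<sigma>: "\<sigma> \<in> automorphisms_over k L" and \<tau>: "\<tau> \<in> automorphisms_over k L" and x: "x \<in> L" for \<sigma> \<tau> x
  proof -
    have power: "\<rho> (y ^ m) = \<rho> y ^ m" if "\<rho> \<in> automorphisms_over k L" "y \<in> L" for \<rho> y m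
      using automorphism_poly[OF L(2,1) that(1) _ that(2), of "Polynomial.monom 1 m"]
        polys_over_closed(7)[OF k] subfield_ambientD(2)[OF k] by (simp add: poly_monom)
    have root: "\<exists>i. \<rho> \<zeta> = \<zeta> ^ i" if \<rho>: "\<rho> \<in> automorphisms_over k L" for \<rho>
      using power[OF \<rho> \<zeta>L, of n] n(2) \<rho> L by (intro pow) (simp add: automorphisms_over_iff)
    obtain i j where ij: "\<sigma> \<zeta> = \<zeta> ^ i" "\<tau> \<zeta> = \<zeta> ^ j" using root[OF \<sigma>] root[OF \<tau>] by blast
    obtain p where p: "p \<in> polys_over k" "x = poly p \<zeta>" using x by (auto simp: L_def adjoin_def)
    have "\<sigma> (\<tau> x) = poly p (\<zeta> ^ (i * j))"
      using automorphism_poly[OF L(2,1) \<tau> p(1) \<zeta>L] automorphism_poly[OF L(2,1) \<sigma> p(1)]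
        subfield_ambientD(9)[OF L(1) \<zeta>L, of j] power[OF \<sigma> \<zeta>L, of j] ij p(2)
      by (simp add: power_mult)
    moreover have "\<tau> (\<sigma> x) = poly p (\<zeta> ^ (i * j))"
      using automorphism_poly[OF L(2,1) \<sigma> p(1) \<zeta>L] automorphism_poly[OF L(2,1) \<tau> p(1)]
        subfield_ambientD(9)[OF L(1) \<zeta>L, of i] power[OF \<tau> \<zeta>L, of i] ij p(2)
      by (simp add: power_mult[symmetric] mult.commute)
    ultimately show ?thesis by simp
  qed
  ultimately show ?thesis by (simp add: abelian_extension_def L_def)
qed

lemma root_of_unity_in_maximal_abelian_extension:
  fixes k :: "'a :: {alg_closed_field, field_char_0} set"
  assumes k: "subfield k ambient" and "root_of_unity \<zeta>"
  shows "\<zeta> \<in> maximal_abelian_extension k"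
  using abelian_extension_subset[OF abelian_extension_root_of_unity[OF assms]] subset_adjoin(2)[OF k]
  by blast

section \<open>Primitive roots of unity\<close>

definition has_order :: "'a :: field \<Rightarrow> nat \<Rightarrow> bool" where
  "has_order \<zeta> n \<longleftrightarrow> (\<forall>i. \<zeta> ^ i = 1 \<longleftrightarrow> n dvd i)"

lemma power_gcd_eq_1:
  fixes x :: "'a :: field"
  assumes "x ^ i = 1" "x ^ j = 1"
  shows "x ^ gcd i j = 1"
proof (cases "i = 0")
  case False
  then obtain a b where "i * a = j * b + gcd i j" using bezout_nat[of i j] by auto
  then have "x ^ (i * a) = x ^ (j * b) * x ^ gcd i j" by (simp add: power_add)
  then show ?thesis using assms by (simp add: power_mult)
qed (use assms in simp)

text \<open>
  Start from a root \<open>u\<close> of \<open>1 + x + \<dots> + x^(p-1)\<close>; it differs from \<open>1\<close> in characteristic zero, so it has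
  order \<open>p\<close>. Extracting a root of exponent \<open>p ^ (e - 1)\<close> raises the order to \<open>p ^ e\<close>.
\<close>

lemma has_order_prime_power:
  fixes p :: nat
  assumes p: "Factorial_Ring.prime p"
  obtains x :: "'a :: {alg_closed_field, field_char_0}" where "has_order x (p ^ e)"
proof (cases e)
  case 0
  then show ?thesis using that[of 1] by (simp add: has_order_def)
next
  case (Suc e')
  define f where "f = (\<Sum>i<p. Polynomial.monom (1 :: 'a) i)"
  have p2: "p \<ge> 2" using p by (rule prime_ge_2_nat)
  have "poly.coeff f (p - 1) = 1"
    using p2 by (simp add: f_def coeff_sum)
  then have "degree f > 0" using le_degree[of f "p - 1"] p2 by fastforce
  then obtain u where u: "poly f u = 0" using alg_closed_imp_poly_has_root by blast
  have sum: "(\<Sum>i<p. u ^ i) = 0" using u by (simp add: f_def poly_sum poly_monom)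
  have "u \<noteq> 1" using sum p2 by auto
  have "u ^ p = 1" using sum power_diff_1_eq[of u p] by simp
  obtain x where x: "x ^ (p ^ e') = u" using nth_root_exists[of "p ^ e'" u] p2 by auto
  have x1: "x ^ (p ^ e) = 1"
  proof -
    have "x ^ (p ^ e) = (x ^ (p ^ e')) ^ p" by (simp add: Suc power_mult[symmetric] mult.commute)
    then show ?thesis using x \<open>u ^ p = 1\<close> by simp
  qed
  have "p ^ e dvd i" if i: "x ^ i = 1" for i
  proof -
    obtain r where r: "r \<le> e" "gcd i (p ^ e) = p ^ r"
      using gcd_dvd2[of i "p ^ e"] divides_primepow_nat[OF p, of "gcd i (p ^ e)" e] by auto
    have xr: "x ^ (p ^ r) = 1" using power_gcd_eq_1[OF i x1] r(2) by simp
    have "r = e"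
    proof (rule ccontr)
      assume "r \<noteq> e"
      then have "e' = r + (e' - r)" using r(1) Suc by simp
      then have "x ^ (p ^ e') = (x ^ (p ^ r)) ^ (p ^ (e' - r))"
        by (metis power_add power_mult)
      then show False using xr x \<open>u \<noteq> 1\<close> by simp
    qed
    then show ?thesis using r(2) gcd_dvd1[of i "p ^ e"] by simp
  qed
  moreover have "x ^ i = 1" if "p ^ e dvd i" for i using that x1 by (auto simp: power_mult elim!: dvdE)
  ultimately show ?thesis using that[of x] by (auto simp: has_order_def)
qed

lemma has_order_mult:
  assumes "has_order x a" "has_order y b" "coprime a b"
  shows "has_order (x * y) (a * b)"
proof -
  have *: "c dvd i"
    if "has_order z c" "has_order w d" "coprime c d" "(z * w) ^ i = 1" for z w :: 'a and c d i
  proof -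
    have "w ^ (d * i) = 1" using that(2) by (simp add: has_order_def)
    moreover have "(z * w) ^ (d * i) = 1" using that(4) by (metis mult.commute power_mult power_one)
    ultimately have "z ^ (d * i) = 1" by (simp add: power_mult_distrib)
    then have "c dvd d * i" using that(1) by (simp add: has_order_def)
    then show ?thesis using that(3) by (simp add: coprime_dvd_mult_right_iff)
  qed
  show ?thesis
    unfolding has_order_def
  proof (intro allI iffI)
    fix i assume "(x * y) ^ i = 1"
    then show "a * b dvd i"
      using *[OF assms(1,2,3)] *[OF assms(2,1)] assms(3)
      by (intro divides_mult) (auto simp: mult.commute coprime_commute)
  next
    fix i assume "a * b dvd i"
    then have "a dvd i" "b dvd i" by (auto intro: dvd_mult_left dvd_mult_right)
    then have "x ^ i = 1" "y ^ i = 1" using assms(1,2) by (auto simp: has_order_def)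
    then show "(x * y) ^ i = 1" by (simp add: power_mult_distrib)
  qed
qed

text \<open>
  Prime powers suffice, because coprime orders multiply.
\<close>

lemma has_order_exists:
  assumes "n \<ge> 1"
  shows "\<exists>x :: 'a :: {alg_closed_field, field_char_0}. has_order x n"
  using assms
proof (induction n rule: less_induct)
  case (less n)
  show ?case
  proof (cases "n = 1")
    case True
    then show ?thesis by (intro exI[of _ 1]) (simp add: has_order_def)
  next
    case False
    then obtain p where p: "Factorial_Ring.prime p" "p dvd n" using prime_factor_nat by blast
    define e where "e = multiplicity p n"
    have "\<not> is_unit p" using p(1) not_prime_unit by blast
    then obtain m where m: "n = p ^ e * m" "\<not> p dvd m"
      using multiplicity_decompose'[of n p] less.prems unfolding e_def by auto
    have "e > 0" using m p(2) by (cases "e = 0") auto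
    then have "p ^ e > 1" using prime_gt_1_nat[OF p(1)] by (intro one_less_power)
    moreover have "m \<ge> 1" using m(1) less.prems by (cases m) auto
    ultimately have "m < n" using m(1) by simp
    from less.IH[OF this \<open>m \<ge> 1\<close>] obtain y :: 'a where y: "has_order y m" by auto
    obtain x :: 'a where x: "has_order x (p ^ e)" by (rule has_order_prime_power[OF p(1)])
    have "coprime (p ^ e) m"
      using prime_imp_coprime_nat[OF p(1) m(2)] by simp
    from has_order_mult[OF x y this] show ?thesis using m(1) by auto
  qed
qed

lemma has_order_powers:
  assumes "has_order \<zeta> n" "n \<ge> 1" "x ^ n = 1"
  obtains i where "x = \<zeta> ^ i" "i \<ge> 1"
proof -
  have "\<exists>i. x = \<zeta> ^ i"
    using assms by (intro roots_of_unity_powers[of n]) (auto simp: has_order_def dest: dvd_imp_le)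
  then obtain i where "x = \<zeta> ^ i" by blast
  \<comment> \<open>the exponent is made positive so that \<open>1\<close> can be subtracted from it\<close>
  then have "x = \<zeta> ^ (i + n)" using assms(1) by (simp add: power_add has_order_def)
  then show ?thesis using that[of "i + n"] assms(2) by simp
qed

lemma has_order_inj_on:
  assumes "has_order \<zeta> n" "n \<ge> 1"
  shows "inj_on (\<lambda>i. \<zeta> ^ i) {..<n}"
proof (rule linorder_inj_onI)
  fix i j assume ij: "i < j" "i \<in> {..<n}" "j \<in> {..<n}"
  show "\<zeta> ^ i \<noteq> \<zeta> ^ j"
  proof
    assume eq: "\<zeta> ^ i = \<zeta> ^ j"
    have "\<zeta> ^ n = 1" using assms(1) by (simp add: has_order_def)
    then have "\<zeta> \<noteq> 0" using assms(2) by (auto simp: power_0_left)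
    moreover have "\<zeta> ^ j = \<zeta> ^ i * \<zeta> ^ (j - i)" using ij by (simp add: power_add[symmetric])
    ultimately have "\<zeta> ^ (j - i) = 1" using eq by simp
    then have "n dvd j - i" using assms(1) by (simp add: has_order_def)
    then show False using ij by (auto dest: dvd_imp_le)
  qed
qed auto

section \<open>Radicals in an abelian extension\<close>

text \<open>
  The exponents \<open>j\<close> for which \<open>a ^ j\<close> is an \<open>n\<close>-th power in \<open>k\<close> are the multiples of the least positive
  one, \<open>g\<close>, and \<open>n\<close> is among them. The claim is that \<open>\<xi> = \<zeta> ^ (n div g)\<close> lies in \<open>k\<close>, where \<open>\<zeta>\<close> is a
  primitive \<open>n\<close>-th root of unity. Suppose that \<open>\<sigma>\<close> moves \<open>\<xi>\<close>, and let \<open>\<sigma> \<zeta> = \<zeta> ^ t\<close>. If \<open>\<tau>\<close>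
  multiplies \<open>y\<close> by \<open>\<epsilon>\<close>, then it multiplies \<open>\<sigma> y\<close> by \<open>\<sigma> \<epsilon> = \<epsilon> ^ t\<close>, because \<open>\<sigma>\<close> and \<open>\<tau>\<close> commute at
  \<open>y\<close>; so \<open>\<sigma> y / y ^ t\<close> is invariant and lies in \<open>k\<close>. Its \<open>n\<close>-th power is \<open>a / a ^ t\<close>, whence \<open>g\<close>
  divides \<open>t - 1\<close>, and then \<open>\<sigma>\<close> fixes \<open>\<xi>\<close> after all.
\<close>

lemma abelian_radical:
  fixes k :: "'a :: {alg_closed_field, field_char_0} set"
  assumes k: "subfield k ambient" and y: "algebraic_over k y" and n: "n \<ge> 1"
    and a: "y ^ n = a" "a \<in> k" "a \<noteq> 0"
    and comm: "\<And>\<sigma> \<tau>. alg_endo k \<sigma> \<Longrightarrow> alg_endo k \<tau> \<Longrightarrow> \<sigma> (\<tau> y) = \<tau> (\<sigma> y)"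
  shows "\<exists>g\<ge>1. (\<exists>w\<in>k. w ^ n = a ^ g) \<and> (\<exists>\<xi>\<in>k. has_order \<xi> g)"
proof -
  note k' = subfield_ambientD[OF k]
  have sA: "subfield {x. algebraic_over k x} ambient" by (rule subfield_algebraic_over[OF k])
  note A = subfield_ambientD[OF sA, simplified]
  define T where "T = {j. \<exists>w\<in>k. w ^ n = a ^ j}"
  have nT: "n \<in> T" using a by (auto simp: T_def)
  define g where "g = (LEAST j. j \<ge> 1 \<and> j \<in> T)"
  have g: "g \<ge> 1" "g \<in> T" and least: "\<And>j. j < g \<Longrightarrow> j \<in> T \<Longrightarrow> j = 0"
    using LeastI[of "\<lambda>j. j \<ge> 1 \<and> j \<in> T" n] not_less_Least[of _ "\<lambda>j. j \<ge> 1 \<and> j \<in> T"] n nT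
    by (auto simp: g_def Suc_le_eq)
  have dvd: "g dvd j" if j: "j \<in> T" for j
  proof -
    obtain v w where v: "v \<in> k" "v ^ n = a ^ g" and w: "w \<in> k" "w ^ n = a ^ j"
      using g(2) j by (auto simp: T_def)
    have "a ^ j = a ^ (g * (j div g)) * a ^ (j mod g)" by (simp add: power_add[symmetric])
    then have "(w / v ^ (j div g)) ^ n = a ^ (j mod g)"
      using v(2) w(2) a(3)
      by (simp add: power_divide power_mult[symmetric] mult.commute[of _ n])
        (simp add: power_mult)
    then have "j mod g \<in> T" using v(1) w(1) k'(8,9) by (auto simp: T_def)
    then have "j mod g = 0" using g(1) by (intro least) auto
    then show ?thesis by auto
  qed
  from dvd[OF nT] obtain m where m: "n = g * m" by (auto elim: dvdE)
  have "m \<ge> 1" using m n by (cases m) auto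
  obtain \<zeta> :: 'a where \<zeta>: "has_order \<zeta> n" using has_order_exists[OF n] by blast
  then have \<zeta>n: "\<zeta> ^ n = 1" by (simp add: has_order_def)
  have alg\<zeta>: "algebraic_over k \<zeta>"
  proof -
    have "poly (Polynomial.monom 1 n - 1) \<zeta> = 0" "Polynomial.monom 1 n - (1 :: 'a poly) \<noteq> 0"
      using n \<zeta>n by (auto simp: poly_monom monom_eq_1_iff)
    moreover have "Polynomial.monom 1 n - 1 \<in> polys_over k"
      by (intro polys_over_closed[OF k] subfield_ambientD[OF k])
    ultimately show ?thesis unfolding algebraic_over_def by blast
  qed
  have y0: "y \<noteq> 0" using a n by (auto simp: power_0_left)
  define \<xi> where "\<xi> = \<zeta> ^ m"
  have "has_order \<xi> g"
    using \<zeta> \<open>m \<ge> 1\<close> by (simp add: has_order_def \<xi>_def power_mult[symmetric] m mult.commute[of m])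
  moreover have "\<xi> \<in> k"
  proof (rule ccontr)
    assume "\<xi> \<notin> k"
    moreover have "algebraic_over k \<xi>" using A(9)[OF alg\<zeta>] by (simp add: \<xi>_def)
    ultimately obtain \<sigma> where \<sigma>: "alg_endo k \<sigma>" "\<sigma> \<xi> \<noteq> \<xi>" using alg_endo_moves[OF k] by metis
    note \<sigma>D = alg_endoD[OF k \<sigma>(1)]
    have "\<sigma> \<zeta> ^ n = 1" using \<sigma>D(9)[OF alg\<zeta>, of n] \<zeta>n \<sigma>D(1)[OF k'(2)] by simp
    then obtain t where t: "\<sigma> \<zeta> = \<zeta> ^ t" "t \<ge> 1" by (rule has_order_powers[OF \<zeta> n])
    have algz: "algebraic_over k (\<sigma> y)" "algebraic_over k (y ^ t)" using \<sigma>D(2)[OF y] A(9)[OF y] by auto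
    define z where "z = \<sigma> y / y ^ t"
    have "z \<in> k"
    proof (rule ccontr)
      assume "z \<notin> k"
      moreover have "algebraic_over k z" unfolding z_def by (rule A(8)[OF algz])
      ultimately obtain \<tau> where \<tau>: "alg_endo k \<tau>" "\<tau> z \<noteq> z" using alg_endo_moves[OF k] by metis
      note \<tau>D = alg_endoD[OF k \<tau>(1)]
      have "\<tau> y ^ n = a" using \<tau>D(9)[OF y, of n] a(1) \<tau>D(1)[OF a(2)] by simp
      then have "(\<tau> y / y) ^ n = 1" using a(1,3) by (simp add: power_divide)
      then obtain e where "\<tau> y / y = \<zeta> ^ e" by (rule has_order_powers[OF \<zeta> n])
      then have \<tau>y: "\<tau> y = \<zeta> ^ e * y" using y0 by (simp add: field_simps)
      have "\<tau> (\<sigma> y) = \<sigma> (\<zeta> ^ e * y)" using comm[OF \<sigma>(1) \<tau>(1)] \<tau>y by simp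
      also have "\<dots> = \<sigma> \<zeta> ^ e * \<sigma> y" by (simp add: \<sigma>D(4)[OF A(9)[OF alg\<zeta>] y] \<sigma>D(9)[OF alg\<zeta>])
      also have "\<dots> = (\<zeta> ^ e) ^ t * \<sigma> y" by (simp add: t(1) power_mult[symmetric] mult.commute)
      finally have "\<tau> z = ((\<zeta> ^ e) ^ t * \<sigma> y) / (\<zeta> ^ e * y) ^ t"
        by (simp add: z_def \<tau>D(5)[OF algz] \<tau>D(9)[OF y] \<tau>y)
      also have "\<dots> = z"
      proof -
        have "\<zeta> \<noteq> 0" using \<zeta>n n by (auto simp: power_0_left)
        then show ?thesis by (simp add: z_def power_mult_distrib)
      qed
      finally show False using \<tau>(2) by simp
    qed
    have "\<sigma> y ^ n = a" using \<sigma>D(9)[OF y, of n] a(1) \<sigma>D(1)[OF a(2)] by simp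
    moreover have "(y ^ t) ^ n = a ^ t" using a(1) by (metis mult.commute power_mult)
    moreover have "a ^ t = a * a ^ (t - 1)" using t(2) by (cases t) auto
    ultimately have "(1 / z) ^ n = a ^ (t - 1)" using a(3) by (simp add: z_def power_divide)
    then have "t - 1 \<in> T" using k'(2) k'(8)[OF k'(2) \<open>z \<in> k\<close>] by (auto simp: T_def)
    then have "g dvd t - 1" by (rule dvd)
    then have "n dvd (t - 1) * m" using m by simp
    then have "\<zeta> ^ ((t - 1) * m) = 1" using \<zeta> by (simp add: has_order_def)
    moreover have "\<zeta> ^ (t * m) = \<zeta> ^ ((t - 1) * m) * \<zeta> ^ m"
      using t(2) by (cases t) (simp_all add: power_add)
    ultimately have "\<sigma> \<xi> = \<xi>" by (simp add: \<xi>_def \<sigma>D(9)[OF alg\<zeta>] t(1) power_mult[symmetric])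
    then show False using \<sigma>(2) by simp
  qed
  moreover obtain w where "w \<in> k" "w ^ n = a ^ g" using g(2) by (auto simp: T_def)
  ultimately show ?thesis using g(1) by blast
qed

section \<open>Radicals in a number field\<close>

lemma int_poly_of_rat_poly:
  fixes p :: "'a :: field_char_0 poly"
  assumes "p \<in> polys_over \<rat>"
  shows "\<exists>c q. c \<noteq> 0 \<and> map_poly of_int q = Polynomial.smult (of_int c) p"
  using assms
proof (induction p)
  case 0
  show ?case by (rule exI[of _ 1], rule exI[of _ 0]) simp
next
  case (pCons a p)
  have "a \<in> \<rat>" using coeff_polys_over[OF pCons.prems, of 0] by simp
  then obtain m n :: int where mn: "a = of_int m / of_int n" "n \<noteq> 0"
    by (metis Rats_cases' less_irrefl)
  have "p \<in> polys_over \<rat>"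
    unfolding polys_over_def using coeff_polys_over[OF pCons.prems, of "Suc _"] by simp
  then obtain c q where cq: "c \<noteq> 0" "map_poly of_int q = Polynomial.smult (of_int c) p"
    using pCons.IH by blast
  have "map_poly of_int (pCons (m * c) (Polynomial.smult n q)) = Polynomial.smult (of_int (c * n)) (pCons a p)"
    using mn cq(2) by (auto simp: poly_eq_iff coeff_map_poly coeff_pCons split: nat.splits)
  then show ?case using cq(1) mn(2) by (intro exI[of _ "c * n"] exI) auto
qed

lemma of_int_poly_mult:
  "map_poly of_int (p * q) = map_poly of_int p * (map_poly of_int q :: 'a :: comm_ring_1 poly)"
  by (simp add: poly_eq_iff coeff_map_poly coeff_mult)

lemma poly_of_int_pcompose_monom:
  "poly (map_poly of_int (pcompose p (Polynomial.monom 1 n))) x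
    = poly (map_poly of_int p) ((x :: 'a :: comm_ring_1) ^ n)"
proof (induction p)
  case (pCons a p)
  have add: "map_poly of_int (p + q) = map_poly of_int p + (map_poly of_int q :: 'a poly)" for p q
    by (simp add: poly_eq_iff coeff_map_poly)
  have "map_poly of_int (Polynomial.monom 1 n) = (Polynomial.monom 1 n :: 'a poly)"
    by (simp add: poly_eq_iff coeff_map_poly)
  then show ?case
    using pCons.IH
    by (simp add: pcompose_pCons add of_int_poly_mult poly_monom map_poly_pCons)
qed simp

text \<open>
  Pseudo-division shows that \<open>f\<close> divides an integer multiple of \<open>h\<close>; the multiplier can be removed by
  Gauss's lemma, since \<open>f\<close> is primitive.
\<close>

lemma primitive_minimal_int_poly_dvd:
  fixes z :: "'a :: field_char_0"
  assumes f: "content f = 1" "poly (map_poly of_int f) z = 0"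
    and min: "\<And>g. g \<noteq> 0 \<Longrightarrow> poly (map_poly of_int g) z = 0 \<Longrightarrow> degree f \<le> degree g"
    and h: "poly (map_poly of_int h) z = 0"
  shows "f dvd h"
proof -
  have "f \<noteq> 0" using f(1) by auto
  define r where "r = pseudo_mod h f"
  obtain a q where aq: "a \<noteq> 0" "Polynomial.smult a h = f * q + r"
    using pseudo_mod(1)[OF \<open>f \<noteq> 0\<close>, of h] unfolding r_def by blast
  have deg: "r = 0 \<or> degree r < degree f"
    unfolding r_def by (rule pseudo_mod(2)[OF \<open>f \<noteq> 0\<close>])
  have "(map_poly of_int r :: 'a poly)
      = Polynomial.smult (of_int a) (map_poly of_int h) - map_poly of_int f * map_poly of_int q"
  proof -
    have "r = Polynomial.smult a h - f * q" using aq(2) by simp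
    then have "map_poly of_int r = map_poly of_int (Polynomial.smult a h) - (map_poly of_int (f * q) :: 'a poly)"
      by (simp add: poly_eq_iff coeff_map_poly)
    also have "map_poly of_int (Polynomial.smult a h) = Polynomial.smult (of_int a) (map_poly of_int h :: 'a poly)"
      by (simp add: poly_eq_iff coeff_map_poly)
    finally show ?thesis by (simp add: of_int_poly_mult)
  qed
  then have "poly (map_poly of_int r) z = 0" using f(2) h by simp
  then have "r = 0" using min[of r] deg by (cases "r = 0") auto
  then have eq: "Polynomial.smult a h = f * q" using aq(2) by simp
  have "content q = content (f * q)" by (simp add: content_mult f(1))
  also have "\<dots> = normalize a * content h" unfolding eq[symmetric] by simp
  finally have "a dvd content q" by simp
  then obtain q' where "q = [:a:] * q'" unfolding const_poly_dvd_iff_dvd_content[symmetric] by (rule dvdE)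
  then have "Polynomial.smult a h = Polynomial.smult a (f * q')" using eq by simp
  then have "h = f * q'" using aq(1) by (metis smult_cancel)
  then show ?thesis by simp
qed

lemma norm_coeff_prod_linear:
  fixes A :: "complex multiset"
  assumes "\<And>w. w \<in># A \<Longrightarrow> norm w \<le> R" "R \<ge> 0"
  shows "norm (poly.coeff (\<Prod>w\<in>#A. [:- w, 1:]) i) \<le> (1 + R) ^ size A"
  using assms(1)
proof (induction A arbitrary: i)
  case empty
  show ?case by (simp add: one_pCons coeff_pCons split: nat.splits)
next
  case (add w A)
  define p where "p = (\<Prod>w\<in>#A. [:- w, 1:])"
  have IH: "norm (poly.coeff p i) \<le> (1 + R) ^ size A" for i
    unfolding p_def using add.prems by (intro add.IH) simp
  have "poly.coeff (\<Prod>w\<in>#add_mset w A. [:- w, 1:]) i = poly.coeff (pCons 0 p) i - w * poly.coeff p i"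
    by (simp add: p_def coeff_pCons split: nat.splits)
  also have "norm \<dots> \<le> norm (poly.coeff (pCons 0 p) i) + norm w * norm (poly.coeff p i)"
    by (metis norm_mult norm_triangle_ineq4)
  also have "\<dots> \<le> (1 + R) ^ size A + R * (1 + R) ^ size A"
  proof (intro add_mono mult_mono)
    show "norm (poly.coeff (pCons 0 p) i) \<le> (1 + R) ^ size A"
      using IH assms(2) by (auto simp: coeff_pCons split: nat.splits)
  qed (use IH add.prems assms(2) in auto)
  also have "\<dots> = (1 + R) ^ size (add_mset w A)" by (simp add: algebra_simps)
  finally show ?case .
qed

lemma finite_bounded_int_polys: "finite {f :: int poly. degree f \<le> d \<and> (\<forall>i. \<bar>poly.coeff f i\<bar> \<le> N)}"
proof (rule finite_subset)
  show "finite (Poly ` {xs. set xs \<subseteq> {- N..N} \<and> length xs \<le> Suc d})"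
    by (intro finite_imageI finite_lists_length_le) simp
  show "{f :: int poly. degree f \<le> d \<and> (\<forall>i. \<bar>poly.coeff f i\<bar> \<le> N)} \<subseteq> \<dots>"
  proof clarify
    fix f :: "int poly" assume f: "degree f \<le> d" "\<forall>i. \<bar>poly.coeff f i\<bar> \<le> N"
    have "set (coeffs f) \<subseteq> {- N..N}" using f(2) by (auto simp: coeffs_def abs_le_iff minus_le_iff)
    moreover have "length (coeffs f) \<le> Suc d" using f(1) by (cases "f = 0") (auto simp: length_coeffs_degree)
    ultimately show "f \<in> Poly ` {xs. set xs \<subseteq> {- N..N} \<and> length xs \<le> Suc d}"
      by (intro image_eqI[of _ _ "coeffs f"]) auto
  qed
qed

text \<open>
  Northcott's argument. Let \<open>g\<close> be an integer polynomial vanishing at \<open>b\<close>. If \<open>z ^ n = b\<close>, then the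
  primitive minimal polynomial \<open>f\<close> of \<open>z\<close> divides \<open>g(x^n)\<close>. So the leading coefficient of \<open>f\<close> divides
  that of \<open>g\<close>, and the \<open>n\<close>-th powers of the complex roots of \<open>f\<close> are roots of \<open>g\<close>, which bounds these
  roots independently of \<open>n\<close>. Together with the bound on the degree, only finitely many \<open>f\<close> remain.
\<close>

lemma finite_radicals_in_number_field:
  fixes k :: "'a :: field_char_0 set"
  assumes k: "number_field k" and b: "b \<in> k"
  shows "finite {z \<in> k. \<exists>n\<ge>1. z ^ n = b}"
proof -
  have ext: "finite_extension \<rat> k" using k by (simp add: number_field_def)
  obtain d where d: "\<And>x. x \<in> k \<Longrightarrow> \<exists>p\<in>polys_over \<rat>. p \<noteq> 0 \<and> degree p \<le> d \<and> poly p x = 0"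
    using finite_extension_bounded_degree[OF ext] by blast
  have int_poly: "\<exists>f :: int poly. f \<noteq> 0 \<and> degree f \<le> d \<and> poly (map_poly of_int f) x = 0"
    if x: "x \<in> k" for x
  proof -
    obtain p where p: "p \<in> polys_over \<rat>" "p \<noteq> 0" "degree p \<le> d" "poly p x = 0" using d[OF x] by blast
    from int_poly_of_rat_poly[OF p(1)] obtain c q where q: "c \<noteq> 0"
      "map_poly of_int q = Polynomial.smult (of_int c) p" by blast
    have "degree (map_poly (of_int :: int \<Rightarrow> 'a) q) = degree q" by (rule degree_map_poly) simp
    then have "degree q \<le> d" using q p(3) by simp
    moreover have "q \<noteq> 0" using q p(2) by auto
    ultimately show ?thesis using q(2) p(4) by (intro exI[of _ q]) simp
  qed
  obtain g :: "int poly" where g: "g \<noteq> 0" "poly (map_poly of_int g) b = 0" using int_poly[OF b] by blast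
  define gC where "gC = map_poly (of_int :: int \<Rightarrow> complex) g"
  have "gC \<noteq> 0" using g(1) unfolding gC_def by (subst map_poly_eq_0_iff) auto
  then have fin: "finite {w. poly gC w = 0}" by (rule poly_roots_finite)
  define R where "R = Max (insert 1 (norm ` {w. poly gC w = 0}))"
  have R1: "R \<ge> 1" unfolding R_def using fin by (intro Max_ge) auto
  have R: "norm w \<le> R" if "poly gC w = 0" for w unfolding R_def using fin that by (intro Max_ge) auto
  define N where "N = \<lceil>\<bar>lead_coeff g\<bar> * (1 + R) ^ d\<rceil>"
  define S where "S = {f :: int poly. degree f \<le> d \<and> (\<forall>i. \<bar>poly.coeff f i\<bar> \<le> N)} - {0}"
  have "z \<in> (\<Union>f\<in>S. {z. poly (map_poly of_int f) z = 0})" if z: "z \<in> k" "n \<ge> 1" "z ^ n = b" for z n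
  proof -
    define P where "P f \<longleftrightarrow> f \<noteq> 0 \<and> poly (map_poly of_int f) z = 0" for f :: "int poly"
    obtain f0 where f0: "P f0" "degree f0 \<le> d" using int_poly[OF z(1)] by (auto simp: P_def)
    obtain f1 where f1: "P f1" and min: "\<And>h. P h \<Longrightarrow> degree f1 \<le> degree h"
      using exists_least_iff[THEN iffD1, of "\<lambda>n. \<exists>g. P g \<and> degree g = n"] f0 by (metis not_less)
    define f where "f = primitive_part f1"
    have f1_eq: "f1 = Polynomial.smult (content f1) f" by (simp add: f_def)
    have cf: "content f = 1" using f1 by (simp add: f_def P_def)
    have c0: "content f1 \<noteq> 0" using f1 by (simp add: P_def)
    have "map_poly of_int (Polynomial.smult (content f1) f)
        = Polynomial.smult (of_int (content f1)) (map_poly of_int f :: 'a poly)"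
      by (simp add: poly_eq_iff coeff_map_poly)
    then have "map_poly of_int f1 = Polynomial.smult (of_int (content f1)) (map_poly of_int f :: 'a poly)"
      unfolding f1_eq[symmetric] .
    then have fz: "poly (map_poly of_int f) z = 0" using f1 c0 by (auto simp: P_def)
    have df: "degree f = degree f1" by (simp add: f_def)
    define h where "h = pcompose g (Polynomial.monom 1 n)"
    have "f dvd h"
    proof (rule primitive_minimal_int_poly_dvd[OF cf fz])
      show "poly (map_poly of_int h) z = 0"
        unfolding h_def poly_of_int_pcompose_monom z(3) by (rule g(2))
      show "degree f \<le> degree g'" if "g' \<noteq> 0" "poly (map_poly of_int g') z = 0" for g'
        unfolding df using that by (intro min) (simp add: P_def)
    qed
    then obtain q where q: "h = f * q" by (rule dvdE)
    have "lead_coeff h = lead_coeff g"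
      using z(2) by (simp add: h_def lead_coeff_comp degree_monom_eq)
    then have "lead_coeff f dvd lead_coeff g" using q by (metis dvd_triv_left lead_coeff_mult)
    then have lc: "\<bar>lead_coeff f\<bar> \<le> \<bar>lead_coeff g\<bar>" using g(1) by (intro dvd_imp_le_int) auto
    define fC where "fC = map_poly (of_int :: int \<Rightarrow> complex) f"
    have "f \<noteq> 0" using cf by auto
    have fC0: "fC \<noteq> 0" using \<open>f \<noteq> 0\<close> unfolding fC_def by (subst map_poly_eq_0_iff) auto
    have dfC: "degree fC = degree f" unfolding fC_def by (rule degree_map_poly) simp
    have coeff_fC: "poly.coeff fC i = of_int (poly.coeff f i)" for i by (simp add: fC_def coeff_map_poly)
    have roots: "norm w \<le> R" if w: "poly fC w = 0" for w
    proof -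
      have "poly (map_poly of_int h) w = 0" using w by (simp add: q of_int_poly_mult fC_def)
      then have "poly gC (w ^ n) = 0" unfolding h_def poly_of_int_pcompose_monom gC_def .
      then have "norm w ^ n \<le> R" using R by (metis norm_power)
      show ?thesis
      proof (rule ccontr)
        assume "\<not> ?thesis"
        moreover from this have "norm w \<le> norm w ^ n" using R1 z(2) by (intro self_le_power) auto
        ultimately show False using \<open>norm w ^ n \<le> R\<close> by simp
      qed
    qed
    define c where "c = lead_coeff fC"
    obtain A where A: "size A = degree fC" "fC = Polynomial.smult c (\<Prod>x\<in>#A. [:- x, 1:])"
      using alg_closed_imp_factorization[OF fC0] unfolding c_def by blast
    have "norm w \<le> R" if "w \<in># A" for w
    proof (rule roots)
      have "0 \<in># image_mset (\<lambda>x. w - x) A" using that by force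
      then show "poly fC w = 0"
        by (subst A(2)) (simp add: poly_prod_mset image_mset.compositionality o_def prod_mset_zero_iff)
    qed
    then have bound: "norm (poly.coeff (\<Prod>x\<in>#A. [:- x, 1:]) i) \<le> (1 + R) ^ size A" for i
      using R1 by (intro norm_coeff_prod_linear) auto
    have "\<bar>poly.coeff f i\<bar> \<le> N" for i
    proof -
      have "real_of_int \<bar>poly.coeff f i\<bar> = norm (poly.coeff fC i)" by (simp add: coeff_fC)
      also have "\<dots> = norm c * norm (poly.coeff (\<Prod>x\<in>#A. [:- x, 1:]) i)"
        by (subst A(2)) (simp add: norm_mult)
      also have "norm c = \<bar>lead_coeff f\<bar>" by (simp add: c_def dfC coeff_fC)
      also have "\<bar>lead_coeff f\<bar> * norm (poly.coeff (\<Prod>x\<in>#A. [:- x, 1:]) i)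
          \<le> \<bar>lead_coeff g\<bar> * (1 + R) ^ d"
      proof (rule mult_mono)
        show "real_of_int \<bar>lead_coeff f\<bar> \<le> \<bar>lead_coeff g\<bar>" using lc by linarith
        have "size A \<le> d" using A(1) dfC df min[OF f0(1)] f0(2) by simp
        then show "norm (poly.coeff (\<Prod>x\<in>#A. [:- x, 1:]) i) \<le> (1 + R) ^ d"
          using bound[of i] power_increasing[of "size A" d "1 + R"] R1 by linarith
      qed auto
      finally show ?thesis unfolding N_def by linarith
    qed
    moreover have "degree f \<le> d" using df min[OF f0(1)] f0(2) by simp
    ultimately have "f \<in> S" using \<open>f \<noteq> 0\<close> by (simp add: S_def)
    then show ?thesis using fz by blast
  qed
  then have "{z \<in> k. \<exists>n\<ge>1. z ^ n = b} \<subseteq> (\<Union>f\<in>S. {z. poly (map_poly of_int f) z = 0})" by blast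
  moreover have "finite (\<Union>f\<in>S. {z :: 'a. poly (map_poly of_int f) z = 0})"
  proof (rule finite_UN_I)
    show "finite S" unfolding S_def using finite_bounded_int_polys by simp
    fix f assume "f \<in> S"
    then have "map_poly (of_int :: int \<Rightarrow> 'a) f \<noteq> 0"
      unfolding S_def by (subst map_poly_eq_0_iff) auto
    then show "finite {z :: 'a. poly (map_poly of_int f) z = 0}" by (rule poly_roots_finite)
  qed
  ultimately show ?thesis by (rule finite_subset)
qed

lemma root_of_unity_power_iff:
  assumes "m \<ge> 1"
  shows "root_of_unity (x ^ m) \<longleftrightarrow> root_of_unity x"
proof
  assume "root_of_unity (x ^ m)"
  then obtain n where "n \<ge> 1" "(x ^ m) ^ n = 1" by (auto simp: root_of_unity_def)
  then show "root_of_unity x"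
    using assms unfolding root_of_unity_def by (intro exI[of _ "m * n"]) (simp add: power_mult)
next
  assume "root_of_unity x"
  then obtain n where "n \<ge> 1" "x ^ n = 1" by (auto simp: root_of_unity_def)
  then show "root_of_unity (x ^ m)"
    unfolding root_of_unity_def by (intro exI[of _ n]) (metis mult.commute power_mult power_one)
qed

text \<open>
  By the pigeonhole principle infinitely many exponents would share a radical \<open>z\<close>; but \<open>z ^ m = z ^ n\<close>
  with \<open>m \<noteq> n\<close> makes \<open>z\<close>, and hence \<open>b\<close>, a root of unity.
\<close>

lemma finite_radical_exponents:
  fixes k :: "'a :: field_char_0 set"
  assumes k: "number_field k" and b: "b \<in> k" "b \<noteq> 0" "\<not> root_of_unity b"
  shows "finite {n. n \<ge> 1 \<and> (\<exists>z\<in>k. z ^ n = b)}" (is "finite ?N")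
proof (rule ccontr)
  assume inf: "infinite ?N"
  define z where "z n = (SOME z. z \<in> k \<and> z ^ n = b)" for n
  have z: "z n \<in> k \<and> z n ^ n = b" if "n \<in> ?N" for n
    unfolding z_def by (rule someI_ex) (use that in blast)
  have "finite (z ` ?N)"
    by (rule finite_subset[OF _ finite_radicals_in_number_field[OF k b(1)]]) (use z in blast)
  from pigeonhole_infinite[OF inf this] obtain m where m: "m \<in> ?N" "infinite {n \<in> ?N. z n = z m}" by blast
  then have "infinite ({n \<in> ?N. z n = z m} - {..m})" by simp
  then have "{n \<in> ?N. z n = z m} - {..m} \<noteq> {}" by (rule infinite_imp_nonempty)
  then obtain n where "n \<in> {n \<in> ?N. z n = z m} - {..m}" by blast
  then have n: "n \<in> ?N" "z n = z m" "n > m" by simp_all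
  have "z m ^ n = z m ^ m * z m ^ (n - m)" using n(3) by (simp add: power_add[symmetric])
  then have "z m ^ (n - m) = 1" using z[OF n(1)] z[OF m(1)] n(2) b(2) by simp
  then have "root_of_unity (z m)"
    unfolding root_of_unity_def using n(3) by (intro exI[of _ "n - m"]) simp
  then have "root_of_unity b" using z[OF m(1)] root_of_unity_power_iff[of m "z m"] m(1) by simp
  then show False using b(3) by simp
qed

section \<open>Finite extensions of the maximal abelian extension\<close>

text \<open>
  The number field \<open>k'\<close> contains enough of \<open>F\<close> for conjugations over it to commute on \<open>F\<close>, so every
  radical of \<open>a\<close> in \<open>F\<close> is subject to \<open>abelian_radical\<close>. The exponent \<open>g\<close> provided there is at most the
  number of roots of unity in \<open>k'\<close>.
\<close>

theorem finite_radical_exponents_over_maximal_abelian_extension: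
  fixes k :: "'a :: {alg_closed_field, field_char_0} set"
  assumes k: "number_field k" and F: "finite_extension (maximal_abelian_extension k) F"
    and a: "a \<in> F" "a \<noteq> 0" "\<not> root_of_unity a"
  shows "finite {n. n \<ge> 1 \<and> (\<exists>y\<in>F. y ^ n = a)}"
proof -
  define K where "K = maximal_abelian_extension k"
  have ext: "finite_extension \<rat> k" using k by (simp add: number_field_def)
  then have sQ: "subfield \<rat> (ambient :: 'a ring)" and sk: "subfield k ambient"
    by (auto simp: finite_extension_def)
  have sK: "subfield K ambient" unfolding K_def by (rule subfield_maximal_abelian_extension)
  have F': "finite_extension K F" using F by (simp add: K_def)
  have algK: "algebraic_over k x" if "x \<in> K" for x
  proof -
    have "L \<subseteq> {x. algebraic_over k x}" if "abelian_extension k L" for L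
      using that by (auto simp: abelian_extension_def galois_extension_def)
    from maximal_abelian_extension_least[OF subfield_algebraic_over[OF sk] this]
    show ?thesis using that by (auto simp: K_def)
  qed
  have algF: "algebraic_over k x" if "x \<in> F" for x
    by (rule algebraic_over_trans[OF sk sK algK finite_extension_algebraic[OF F' that]])
  obtain xs where xs: "set xs \<subseteq> F"
    and gen: "\<And>M. subfield M ambient \<Longrightarrow> K \<subseteq> M \<Longrightarrow> set xs \<subseteq> M \<Longrightarrow> F \<subseteq> M"
    using finite_extension_generators[OF F'] by metis
  have "algebraic_over k x" if "x \<in> insert a (set xs)" for x
    using that xs a(1) by (intro algF) auto
  then obtain k' where k': "finite_extension k k'" "insert a (set xs) \<subseteq> k'"
    using finite_extension_adjoin_set[OF sk, of "insert a (set xs)"] by auto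
  then have sk': "subfield k' ambient" and kk': "k \<subseteq> k'" by (auto simp: finite_extension_def)
  have nf: "number_field k'" using finite_extension_trans[OF ext k'(1)] by (simp add: number_field_def)
  have comm: "\<sigma> (\<tau> y) = \<tau> (\<sigma> y)" if \<sigma>: "alg_endo k' \<sigma>" and \<tau>: "alg_endo k' \<tau>" and y: "y \<in> F" for \<sigma> \<tau> y
  proof -
    note mono = alg_endo_mono[OF sk sk' kk' finite_extension_algebraic[OF k'(1)]]
    have \<sigma>k: "alg_endo k \<sigma>" and \<tau>k: "alg_endo k \<tau>" using mono \<sigma> \<tau> by blast+
    define M where "M = {x. algebraic_over k x \<and> \<sigma> (\<tau> x) = \<tau> (\<sigma> x)}"
    have "subfield M ambient"
      unfolding M_def
      by (rule subfield_equalizer[OF sk alg_endo_comp[OF \<sigma>k \<tau>k] alg_endo_comp[OF \<tau>k \<sigma>k]])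
    moreover have "K \<subseteq> M" unfolding M_def K_def by (rule alg_endo_commute_abelian[OF sk \<sigma>k \<tau>k])
    moreover have "set xs \<subseteq> M"
    proof
      fix x assume x: "x \<in> set xs"
      then have "\<sigma> x = x" "\<tau> x = x" using k'(2) alg_endoD(1)[OF sk' \<sigma>] alg_endoD(1)[OF sk' \<tau>] by auto
      then show "x \<in> M" using x xs algF by (auto simp: M_def)
    qed
    ultimately have "F \<subseteq> M" by (rule gen)
    then show ?thesis using y by (auto simp: M_def)
  qed
  define U where "U = {z \<in> k'. \<exists>n\<ge>1. z ^ n = 1}"
  have finU: "finite U"
    unfolding U_def by (rule finite_radicals_in_number_field[OF nf subfield_ambientD(2)[OF sk']])
  \<comment> \<open>an element of order \<open>g\<close> has \<open>g\<close> distinct powers, all of them in \<open>U\<close>\<close>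
  have "n \<in> (\<Union>g\<in>{1..card U}. {n. n \<ge> 1 \<and> (\<exists>w\<in>k'. w ^ n = a ^ g)})"
    if n: "n \<ge> 1" and y: "y \<in> F" "y ^ n = a" for n y
  proof -
    have alg: "algebraic_over k' y" using algebraic_over_mono[OF kk' algF[OF y(1)]] .
    have ak: "a \<in> k'" using k'(2) by simp
    have comm_y: "\<sigma> (\<tau> y) = \<tau> (\<sigma> y)" if "alg_endo k' \<sigma>" "alg_endo k' \<tau>" for \<sigma> \<tau>
      by (rule comm[OF that y(1)])
    have "\<exists>g\<ge>1. (\<exists>w\<in>k'. w ^ n = a ^ g) \<and> (\<exists>\<xi>\<in>k'. has_order \<xi> g)"
      by (rule abelian_radical[OF sk' alg n y(2) ak a(2)]) (rule comm_y)
    then obtain g \<xi> w where g: "g \<ge> 1" "w \<in> k'" "w ^ n = a ^ g" "\<xi> \<in> k'" "has_order \<xi> g"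
      by blast
    have "(\<lambda>i. \<xi> ^ i) ` {..<g} \<subseteq> U"
    proof clarify
      fix i
      have "(\<xi> ^ i) ^ g = 1" using g(5) by (simp add: has_order_def power_mult[symmetric])
      then show "\<xi> ^ i \<in> U" using g(1) subfield_ambientD(9)[OF sk' g(4)] by (auto simp: U_def)
    qed
    from card_mono[OF finU this] have "g \<le> card U"
      using has_order_inj_on[OF g(5,1)] by (simp add: card_image)
    then show ?thesis using g n by auto
  qed
  then have "{n. n \<ge> 1 \<and> (\<exists>y\<in>F. y ^ n = a)}
      \<subseteq> (\<Union>g\<in>{1..card U}. {n. n \<ge> 1 \<and> (\<exists>w\<in>k'. w ^ n = a ^ g)})" by blast
  moreover have "finite (\<Union>g\<in>{1..card U}. {n. n \<ge> 1 \<and> (\<exists>w\<in>k'. w ^ n = a ^ g)})"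
  proof (intro finite_UN_I finite_atLeastAtMost finite_radical_exponents[OF nf])
    fix g assume "g \<in> {1..card U}"
    then show "\<not> root_of_unity (a ^ g)" using a(3) root_of_unity_power_iff by auto
    show "a ^ g \<in> k'" using k'(2) subfield_ambientD(9)[OF sk'] by auto
    show "a ^ g \<noteq> 0" using a(2) by simp
  qed
  ultimately show ?thesis by (rule finite_subset)
qed

text \<open>
  In the equation \<open>x ^ n = \<zeta> * a\<close> the factor \<open>\<zeta>\<close> can be absorbed into \<open>x\<close>, because its \<open>n\<close>-th roots are
  again roots of unity and lie in \<open>F\<close>.
\<close>

lemma rootless_modtor_if_finite_radical_exponents:
  fixes F :: "'a :: alg_closed_field set"
  assumes F: "subfield F ambient" and mu: "\<And>\<zeta>. root_of_unity \<zeta> \<Longrightarrow> \<zeta> \<in> F"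
    and fin: "\<And>a. a \<in> F \<Longrightarrow> a \<noteq> 0 \<Longrightarrow> \<not> root_of_unity a \<Longrightarrow> finite {n. n \<ge> 1 \<and> (\<exists>y\<in>F. y ^ n = a)}"
  shows "rootless_modtor F"
  unfolding rootless_modtor_def
proof (intro ballI impI)
  fix a assume a: "a \<in> F" "a \<noteq> 0 \<and> \<not> root_of_unity a"
  have "\<exists>y\<in>F. y ^ n = a" if n: "n \<ge> 1" and \<zeta>: "root_of_unity \<zeta>" and x: "x \<in> F" "x ^ n = \<zeta> * a" for n \<zeta> x
  proof -
    obtain \<xi> where \<xi>: "\<xi> ^ n = \<zeta>" using nth_root_exists[of n \<zeta>] n by auto
    have "\<zeta> \<noteq> 0" using \<zeta> by (auto simp: root_of_unity_def power_0_left)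
    have "\<xi> \<in> F" using mu \<zeta> root_of_unity_power_iff[OF n, of \<xi>] \<xi> by simp
    then have "x / \<xi> \<in> F" by (rule subfield_ambientD(8)[OF F x(1)])
    moreover have "(x / \<xi>) ^ n = a" using \<xi> x(2) \<open>\<zeta> \<noteq> 0\<close> by (simp add: power_divide)
    ultimately show ?thesis by blast
  qed
  then have "{n. \<not> (n \<ge> 1 \<longrightarrow> (\<forall>\<zeta>\<in>F. root_of_unity \<zeta> \<longrightarrow> \<not> (\<exists>x\<in>F. x ^ n = \<zeta> * a)))}
      \<subseteq> {n. n \<ge> 1 \<and> (\<exists>y\<in>F. y ^ n = a)}" by blast
  then show "rootless_modtor_element F a"
    unfolding rootless_modtor_element_def MOST_iff_cofinite
    using fin[of a] a by (blast intro: finite_subset)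
qed

theorem corollary36:
  fixes k :: "'a :: {alg_closed_field, field_char_0} set"
  assumes "number_field k"
  shows "(rootless_modtor (maximal_abelian_extension k) \<and>
          (\<forall>F. finite_extension (maximal_abelian_extension k) F \<longrightarrow> rootless_modtor F)) \<and>
         (field_has_good_heredity (maximal_abelian_extension k) \<and>
          (\<forall>F. finite_extension (maximal_abelian_extension k) F \<longrightarrow> field_has_good_heredity F))"
proof -
  define K where "K = maximal_abelian_extension k"
  have k: "subfield k ambient" using assms by (simp add: number_field_def finite_extension_def)
  have "rootless_modtor F \<and> field_has_good_heredity F" if ext: "finite_extension K F" for F
  proof -
    have F: "subfield F ambient" "K \<subseteq> F" using ext by (auto simp: finite_extension_def)
    have mu: "\<zeta> \<in> F" if "root_of_unity \<zeta>" for \<zeta>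
      using root_of_unity_in_maximal_abelian_extension[OF k that] F(2) by (auto simp: K_def)
    note fin = finite_radical_exponents_over_maximal_abelian_extension[OF assms, folded K_def]
    have "rootless_modtor F"
      by (rule rootless_modtor_if_finite_radical_exponents[OF F(1) mu fin[OF ext]])
    moreover have "field_has_good_heredity F"
    proof (rule good_heredity_if_roots_bounded[OF F(1) mu])
      fix \<alpha> assume \<alpha>: "algebraic_over F \<alpha>" "\<alpha> \<noteq> 0" "\<not> root_of_unity \<alpha>"
      have "finite_extension K (adjoin F \<alpha>)"
        by (rule finite_extension_trans[OF ext finite_extension_adjoin[OF F(1) \<alpha>(1)]])
      then show "finite {n. n \<ge> 1 \<and> (\<exists>x\<in>adjoin F \<alpha>. x ^ n = \<alpha>)}"
        using subset_adjoin(2)[OF F(1)] \<alpha>(2,3) by (rule fin)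
    qed
    ultimately show ?thesis ..
  qed
  moreover have "finite_extension K K"
    unfolding K_def by (rule finite_extension_refl[OF subfield_maximal_abelian_extension])
  ultimately show ?thesis unfolding K_def by blast
qed

end
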